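(* Let $A$, $B$, $D$ be $C^*$-algebras, let $\beta$ be a $C^*$-norm on $D\odot A$, and let $\rho\colon D\otimes_\beta A\to B$ be a $*$-homomorphism. Let $f$ be either a compact element of $D$, or an element of $D$ such that $0$ is isolated in the spectrum of $|f|$. Then the slice map $A\to B$ given by $a\mapsto\rho(f\otimes a)$ maps the Pedersen ideal of $A$ into the Pedersen ideal of $B$.
   Context: The Pedersen ideal of a $C^*$-algebra is its minimal dense two-sided ideal. Given positive elements $a,b$ of a $C^*$-algebra, $a$ is compact with respect to $b$ if some positive element $e$ of the hereditary subalgebra generated by $b$ acts as a unit on $a$, i.e. $ae=a$. A positive element $a$ is compact if it is compact with respect to itself. $D\otimes_\beta A$ is the completion of the algebraic tensor product $D\odot A$ in the norm $\beta$. *)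

theory Defs
  imports "HOL-Analysis.Analysis" "HOL-Library.Poly_Mapping"
begin

section \<open>Complex vector spaces and complex star-algebras\<close>

class complex_vector = ab_group_add +
  fixes scaleC :: "complex \<Rightarrow> 'a \<Rightarrow> 'a"  (infixr \<open>*\<^sub>C\<close> 75)
  assumes scaleC_add_right: "a *\<^sub>C (x + y) = a *\<^sub>C x + a *\<^sub>C y"
    and scaleC_add_left: "(a + b) *\<^sub>C x = a *\<^sub>C x + b *\<^sub>C x"
    and scaleC_scaleC: "a *\<^sub>C b *\<^sub>C x = (a * b) *\<^sub>C x"
    and scaleC_one: "1 *\<^sub>C x = x"

interpretation complex_vector: vector_space "scaleC :: complex \<Rightarrow> 'a \<Rightarrow> 'a::complex_vector"
  by unfold_locales (rule scaleC_add_right scaleC_add_left scaleC_scaleC scaleC_one)+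

text \<open>Not assumed to be unital.\<close>

class complex_star_algebra = complex_vector + ring +
  fixes star :: "'a \<Rightarrow> 'a"
  assumes scaleC_mult_left: "(c *\<^sub>C x) * y = c *\<^sub>C (x * y)"
    and scaleC_mult_right: "x * (c *\<^sub>C y) = c *\<^sub>C (x * y)"
    and star_add: "star (x + y) = star x + star y"
    and star_scaleC: "star (c *\<^sub>C x) = cnj c *\<^sub>C star x"
    and star_mult: "star (x * y) = star y * star x"
    and star_star: "star (star x) = x"

definition star_hom :: "('a::complex_star_algebra \<Rightarrow> 'b::complex_star_algebra) \<Rightarrow> bool" where
  "star_hom h \<longleftrightarrow> Vector_Spaces.linear (*\<^sub>C) (*\<^sub>C) h \<and>
     (\<forall>x y. h (x * y) = h x * h y) \<and> (\<forall>x. h (star x) = star (h x))"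

definition two_sided_ideal :: "'a::complex_star_algebra set \<Rightarrow> bool" where
  "two_sided_ideal I \<longleftrightarrow> complex_vector.subspace I \<and> (\<forall>x\<in>I. \<forall>y. x * y \<in> I \<and> y * x \<in> I)"

definition star_subalgebra :: "'a::complex_star_algebra set \<Rightarrow> bool" where
  "star_subalgebra S \<longleftrightarrow>
     complex_vector.subspace S \<and> (\<forall>x\<in>S. \<forall>y\<in>S. x * y \<in> S) \<and> (\<forall>x\<in>S. star x \<in> S)"


section \<open>Spectrum\<close>

definition is_unit_element :: "'a::ring \<Rightarrow> bool" where
  "is_unit_element u \<longleftrightarrow> (\<forall>x. u * x = x \<and> x * u = x)"

text \<open>Pairs \<open>(x, a)\<close> stand for \<open>x + a 1\<close> in the unitization.\<close>

definition unitization_mult ::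
  "'a::complex_star_algebra \<times> complex \<Rightarrow> 'a \<times> complex \<Rightarrow> 'a \<times> complex" where
  "unitization_mult p q =
     (fst p * fst q + snd p *\<^sub>C fst q + snd q *\<^sub>C fst p, snd p * snd q)"

definition unitization_invertible :: "'a::complex_star_algebra \<times> complex \<Rightarrow> bool" where
  "unitization_invertible p \<longleftrightarrow>
     (\<exists>q. unitization_mult p q = (0, 1) \<and> unitization_mult q p = (0, 1))"

text \<open>The spectrum is computed in the algebra itself if it has a unit, and in its unitization
  otherwise.\<close>

definition spectrum :: "'a::complex_star_algebra \<Rightarrow> complex set" where
  "spectrum x =
     (if \<exists>u::'a. is_unit_element u
      then {z. \<forall>u. is_unit_element u \<longrightarrow>
                 \<not> (\<exists>y. (x - z *\<^sub>C u) * y = u \<and> y * (x - z *\<^sub>C u) = u)}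
      else {z. \<not> unitization_invertible (x, - z)})"


section \<open>C*-algebras\<close>

class cstar_algebra = complex_star_algebra + real_normed_algebra + banach +
  assumes scaleR_scaleC: "r *\<^sub>R x = complex_of_real r *\<^sub>C x"
    and norm_scaleC: "norm (c *\<^sub>C x) = cmod c * norm x"
    and cstar_identity: "norm (star x * x) = (norm x)\<^sup>2"

definition positive :: "'a::cstar_algebra \<Rightarrow> bool" where
  "positive x \<longleftrightarrow> star x = x \<and> spectrum x \<subseteq> complex_of_real ` {0..}"

definition pos_sqrt :: "'a::cstar_algebra \<Rightarrow> 'a" where
  "pos_sqrt x = (THE y. positive y \<and> y * y = x)"

definition cstar_abs :: "'a::cstar_algebra \<Rightarrow> 'a" where
  "cstar_abs x = pos_sqrt (star x * x)"

text \<open>Ideals are not required to be closed. \<open>LEAST\<close> refers to inclusion: the dense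
  ideals have a least element because the product of two of them is again dense and contained in
  both, so that minimal and least coincide once a minimal one exists.\<close>

definition pedersen_ideal :: "'a::cstar_algebra set" where
  "pedersen_ideal = (LEAST I. two_sided_ideal I \<and> closure I = UNIV)"

text \<open>In \<open>hereditary_subalgebra\<close> the premise \<open>positive (y - x)\<close> is the order relation
  \<open>x \<le> y\<close>.\<close>

definition hereditary_subalgebra :: "'a::cstar_algebra set \<Rightarrow> bool" where
  "hereditary_subalgebra H \<longleftrightarrow> star_subalgebra H \<and> closed H \<and>
     (\<forall>y\<in>H. \<forall>x. positive x \<and> positive (y - x) \<longrightarrow> x \<in> H)"

definition compact_wrt :: "'a::cstar_algebra \<Rightarrow> 'a \<Rightarrow> bool" where
  "compact_wrt a b \<longleftrightarrow> positive a \<and> positive b \<and>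
     (\<exists>e \<in> hereditary_subalgebra hull {b}. positive e \<and> a * e = a)"

definition compact_element :: "'a::cstar_algebra \<Rightarrow> bool" where
  "compact_element a \<longleftrightarrow> compact_wrt a a"


section \<open>The algebraic tensor product\<close>

subsection \<open>Free complex vector spaces\<close>

instantiation complex :: complex_vector
begin
definition scaleC_complex :: "complex \<Rightarrow> complex \<Rightarrow> complex" where
  "scaleC_complex a x = a * x"
instance
  by standard (auto simp: scaleC_complex_def algebra_simps)
end

instantiation poly_mapping :: (type, complex_vector) complex_vector
begin

lift_definition scaleC_poly_mapping :: "complex \<Rightarrow> ('a \<Rightarrow>\<^sub>0 'b) \<Rightarrow> 'a \<Rightarrow>\<^sub>0 'b"
  is "\<lambda>c f k. c *\<^sub>C f k"
  by (erule finite_subset[rotated]) auto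

instance
  by standard
    (transfer; simp add: fun_eq_iff scaleC_add_right scaleC_add_left scaleC_scaleC scaleC_one)+

end

lemma lookup_scaleC: "Poly_Mapping.lookup (c *\<^sub>C F) k = c *\<^sub>C Poly_Mapping.lookup F k"
  by transfer simp

definition free_elem :: "'k \<Rightarrow> 'k \<Rightarrow>\<^sub>0 complex" where
  "free_elem k = Poly_Mapping.single k 1"

definition free_extend :: "('k \<Rightarrow> 'v::complex_vector) \<Rightarrow> ('k \<Rightarrow>\<^sub>0 complex) \<Rightarrow> 'v" where
  "free_extend \<phi> F = (\<Sum>k\<in>Poly_Mapping.keys F. Poly_Mapping.lookup F k *\<^sub>C \<phi> k)"

lift_definition free_cnj :: "('k \<Rightarrow>\<^sub>0 complex) \<Rightarrow> 'k \<Rightarrow>\<^sub>0 complex" is "\<lambda>f k. cnj (f k)"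
  by (erule finite_subset[rotated]) auto

lemma lookup_free_cnj: "Poly_Mapping.lookup (free_cnj F) k = cnj (Poly_Mapping.lookup F k)"
  by transfer simp

lemma free_extend_superset:
  assumes "finite S" "Poly_Mapping.keys F \<subseteq> S"
  shows "free_extend \<phi> F = (\<Sum>k\<in>S. Poly_Mapping.lookup F k *\<^sub>C \<phi> k)"
  unfolding free_extend_def
  by (rule sum.mono_neutral_left) (use assms in \<open>auto simp: in_keys_iff\<close>)

lemma free_extend_add: "free_extend \<phi> (F + G) = free_extend \<phi> F + free_extend \<phi> G"
proof -
  let ?S = "Poly_Mapping.keys F \<union> Poly_Mapping.keys G"
  have "free_extend \<phi> (F + G) = (\<Sum>k\<in>?S. Poly_Mapping.lookup (F + G) k *\<^sub>C \<phi> k)"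
    by (rule free_extend_superset) (auto simp: Poly_Mapping.keys_add)
  moreover have "free_extend \<phi> F = (\<Sum>k\<in>?S. Poly_Mapping.lookup F k *\<^sub>C \<phi> k)"
    by (rule free_extend_superset) auto
  moreover have "free_extend \<phi> G = (\<Sum>k\<in>?S. Poly_Mapping.lookup G k *\<^sub>C \<phi> k)"
    by (rule free_extend_superset) auto
  ultimately show ?thesis
    by (simp add: lookup_add scaleC_add_left sum.distrib)
qed

lemma free_extend_scaleC: "free_extend \<phi> (c *\<^sub>C F) = c *\<^sub>C free_extend \<phi> F"
proof -
  have "free_extend \<phi> (c *\<^sub>C F) =
      (\<Sum>k\<in>Poly_Mapping.keys F. Poly_Mapping.lookup (c *\<^sub>C F) k *\<^sub>C \<phi> k)"
    by (rule free_extend_superset) (auto simp: in_keys_iff lookup_scaleC)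
  then show ?thesis
    by (simp add: free_extend_def lookup_scaleC scaleC_complex_def scaleC_scaleC
        complex_vector.scale_sum_right)
qed

lemma free_extend_zero [simp]: "free_extend \<phi> 0 = 0"
  by (simp add: free_extend_def)

lemma free_extend_uminus: "free_extend \<phi> (- F) = - free_extend \<phi> F"
  using free_extend_add[of \<phi> F "- F"] by (simp add: minus_unique)

lemma free_extend_diff: "free_extend \<phi> (F - G) = free_extend \<phi> F - free_extend \<phi> G"
  using free_extend_add[of \<phi> F "- G"] by (simp add: free_extend_uminus)

lemma free_extend_elem [simp]: "free_extend \<phi> (free_elem k) = \<phi> k"
  by (simp add: free_extend_def free_elem_def scaleC_one)

lemma free_extend_elem_id: "free_extend free_elem F = F"
proof (rule poly_mapping_eqI)
  fix j
  have "Poly_Mapping.lookup (free_extend free_elem F) j =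
      (\<Sum>k\<in>Poly_Mapping.keys F. Poly_Mapping.lookup F k * (if k = j then 1 else 0))"
    by (simp add: free_extend_def lookup_sum lookup_scaleC scaleC_complex_def free_elem_def
        lookup_single when_def)
  also have "\<dots> = Poly_Mapping.lookup F j"
    by (auto simp: if_distrib cong: if_cong simp: in_keys_iff)
  finally show "Poly_Mapping.lookup (free_extend free_elem F) j = Poly_Mapping.lookup F j" .
qed

lemma free_induct [case_names zero add scale elem]:
  assumes "P 0" "\<And>F G. P F \<Longrightarrow> P G \<Longrightarrow> P (F + G)" "\<And>c F. P F \<Longrightarrow> P (c *\<^sub>C F)"
    and "\<And>k. P (free_elem k)"
  shows "P F"
proof -
  have "P (\<Sum>k\<in>S. Poly_Mapping.lookup F k *\<^sub>C free_elem k)" for S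
    by (induction S rule: infinite_finite_induct) (use assms in auto)
  then have "P (free_extend free_elem F)"
    by (simp add: free_extend_def)
  then show ?thesis by (simp add: free_extend_elem_id)
qed

lemma free_extend_pointwise_add:
  "free_extend (\<lambda>k. \<phi> k + \<psi> k) F = free_extend \<phi> F + free_extend \<psi> F"
  by (simp add: free_extend_def scaleC_add_right sum.distrib)

lemma free_extend_pointwise_scaleC:
  "free_extend (\<lambda>k. c *\<^sub>C \<phi> k) F = c *\<^sub>C free_extend \<phi> F"
  by (simp add: free_extend_def scaleC_scaleC mult.commute complex_vector.scale_sum_right)

lemma free_cnj_simps:
  "free_cnj 0 = 0" "free_cnj (F + G) = free_cnj F + free_cnj G"
  "free_cnj (c *\<^sub>C F) = cnj c *\<^sub>C free_cnj F" "free_cnj (F - G) = free_cnj F - free_cnj G"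
  "free_cnj (free_elem k) = free_elem k"
  by (auto intro!: poly_mapping_eqI simp: lookup_free_cnj lookup_add lookup_minus lookup_scaleC
      scaleC_complex_def free_elem_def lookup_single when_def)


subsection \<open>The quotient by the bilinearity relations\<close>

definition tensor_relations ::
    "(('d::complex_vector \<times> 'a::complex_vector) \<Rightarrow>\<^sub>0 complex) set" where
  "tensor_relations =
     {free_elem (d + d', a) - free_elem (d, a) - free_elem (d', a) | d d' a. True} \<union>
     {free_elem (d, a + a') - free_elem (d, a) - free_elem (d, a') | d a a'. True} \<union>
     {free_elem (c *\<^sub>C d, a) - c *\<^sub>C free_elem (d, a) | c d a. True} \<union>
     {free_elem (d, c *\<^sub>C a) - c *\<^sub>C free_elem (d, a) | c d a. True}"

definition tensor_null ::
    "(('d::complex_vector \<times> 'a::complex_vector) \<Rightarrow>\<^sub>0 complex) set" where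
  "tensor_null = complex_vector.span tensor_relations"

definition tensor_rel ::
    "(('d::complex_vector \<times> 'a::complex_vector) \<Rightarrow>\<^sub>0 complex) \<Rightarrow> ('d \<times> 'a \<Rightarrow>\<^sub>0 complex) \<Rightarrow> bool" where
  "tensor_rel F G \<longleftrightarrow> F - G \<in> tensor_null"

lemma tensor_null_zero: "0 \<in> tensor_null"
  and tensor_null_add: "F \<in> tensor_null \<Longrightarrow> G \<in> tensor_null \<Longrightarrow> F + G \<in> tensor_null"
  and tensor_null_diff: "F \<in> tensor_null \<Longrightarrow> G \<in> tensor_null \<Longrightarrow> F - G \<in> tensor_null"
  and tensor_null_neg: "F \<in> tensor_null \<Longrightarrow> - F \<in> tensor_null"
  and tensor_null_scaleC: "F \<in> tensor_null \<Longrightarrow> c *\<^sub>C F \<in> tensor_null"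
  by (simp_all add: tensor_null_def complex_vector.span_zero complex_vector.span_add
      complex_vector.span_diff complex_vector.span_neg complex_vector.span_scale)

quotient_type (overloaded) ('d, 'a) atensor =
  "('d::complex_vector \<times> 'a::complex_vector) \<Rightarrow>\<^sub>0 complex" / tensor_rel
proof (rule equivpI)
  show "reflp tensor_rel"
    by (rule reflpI) (simp add: tensor_rel_def tensor_null_zero)
  show "symp tensor_rel"
    by (rule sympI) (use tensor_null_neg in \<open>force simp: tensor_rel_def\<close>)
  show "transp tensor_rel"
    by (rule transpI) (use tensor_null_add in \<open>force simp: tensor_rel_def\<close>)
qed

lift_definition tensor :: "'d::complex_vector \<Rightarrow> 'a::complex_vector \<Rightarrow> ('d, 'a) atensor"
    (infixr \<open>\<otimes>\<^sub>a\<close> 70)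
  is "\<lambda>d a. free_elem (d, a)" .

instantiation atensor :: (complex_vector, complex_vector) complex_vector
begin

lift_definition zero_atensor :: "('a, 'b) atensor" is 0 .

lift_definition plus_atensor :: "('a, 'b) atensor \<Rightarrow> ('a, 'b) atensor \<Rightarrow> ('a, 'b) atensor" is "(+)"
  unfolding tensor_rel_def by (subst add_diff_add) (rule tensor_null_add)

lift_definition minus_atensor :: "('a, 'b) atensor \<Rightarrow> ('a, 'b) atensor \<Rightarrow> ('a, 'b) atensor" is "(-)"
proof -
  fix F F' G G' :: "'a \<times> 'b \<Rightarrow>\<^sub>0 complex"
  assume "tensor_rel F F'" "tensor_rel G G'"
  then have "(F - F') - (G - G') \<in> tensor_null"
    unfolding tensor_rel_def by (rule tensor_null_diff)
  then show "tensor_rel (F - G) (F' - G')"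
    by (simp add: tensor_rel_def algebra_simps)
qed

lift_definition uminus_atensor :: "('a, 'b) atensor \<Rightarrow> ('a, 'b) atensor" is uminus
  unfolding tensor_rel_def by (drule tensor_null_neg) simp

lift_definition scaleC_atensor :: "complex \<Rightarrow> ('a, 'b) atensor \<Rightarrow> ('a, 'b) atensor" is scaleC
  unfolding tensor_rel_def
  by (subst complex_vector.scale_right_diff_distrib[symmetric]) (rule tensor_null_scaleC)

instance
  by standard
    (transfer; simp add: tensor_rel_def tensor_null_zero scaleC_add_right scaleC_add_left
      scaleC_scaleC scaleC_one algebra_simps)+

end


subsection \<open>The star-algebra structure\<close>

text \<open>On elementary tensors, \<open>(d \<otimes> a) (d' \<otimes> a') = d d' \<otimes> a a'\<close> and
  \<open>(d \<otimes> a)\<^sup>* = d\<^sup>* \<otimes> a\<^sup>*\<close>; these are extended bilinearly and conjugate-linearly,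
  respectively.\<close>

definition free_mult ::
  "(('d::complex_star_algebra \<times> 'a::complex_star_algebra) \<Rightarrow>\<^sub>0 complex) \<Rightarrow>
    ('d \<times> 'a \<Rightarrow>\<^sub>0 complex) \<Rightarrow> ('d \<times> 'a \<Rightarrow>\<^sub>0 complex)" where
  "free_mult F G =
     free_extend (\<lambda>p. free_extend (\<lambda>q. free_elem (fst p * fst q, snd p * snd q)) G) F"

definition free_star ::
  "(('d::complex_star_algebra \<times> 'a::complex_star_algebra) \<Rightarrow>\<^sub>0 complex) \<Rightarrow>
    ('d \<times> 'a \<Rightarrow>\<^sub>0 complex)" where
  "free_star F = free_extend (\<lambda>p. free_elem (star (fst p), star (snd p))) (free_cnj F)"

lemma free_mult_simps:
  "free_mult 0 G = 0" "free_mult F 0 = 0"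
  "free_mult (F + F') G = free_mult F G + free_mult F' G"
  "free_mult F (G + G') = free_mult F G + free_mult F G'"
  "free_mult (c *\<^sub>C F) G = c *\<^sub>C free_mult F G"
  "free_mult F (c *\<^sub>C G) = c *\<^sub>C free_mult F G"
  "free_mult (free_elem p) (free_elem q) = free_elem (fst p * fst q, snd p * snd q)"
  by (simp_all add: free_mult_def free_extend_add free_extend_scaleC free_extend_pointwise_add
      free_extend_pointwise_scaleC) (simp add: free_extend_def)

lemma free_mult_diff:
  "free_mult (F - F') G = free_mult F G - free_mult F' G"
  "free_mult F (G - G') = free_mult F G - free_mult F G'"
  subgoal using free_mult_simps(3)[of "F - F'" F' G] by (simp add: eq_diff_eq)
  subgoal using free_mult_simps(4)[of F "G - G'" G'] by (simp add: eq_diff_eq)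
  done

lemma free_star_simps:
  "free_star 0 = 0" "free_star (F + G) = free_star F + free_star G"
  "free_star (F - G) = free_star F - free_star G"
  "free_star (c *\<^sub>C F) = cnj c *\<^sub>C free_star F"
  "free_star (free_elem p) = free_elem (star (fst p), star (snd p))"
  by (simp_all add: free_star_def free_cnj_simps free_extend_add free_extend_diff
      free_extend_scaleC)

lemma free_mult_assoc: "free_mult (free_mult F G) H = free_mult F (free_mult G H)"
proof (induction F rule: free_induct)
  case (elem p)
  show ?case
  proof (induction G rule: free_induct)
    case (elem q)
    show ?case
      by (induction H rule: free_induct) (simp_all add: free_mult_simps mult.assoc)
  qed (simp_all add: free_mult_simps)
qed (simp_all add: free_mult_simps)

lemma free_star_mult: "free_star (free_mult F G) = free_mult (free_star G) (free_star F)"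
proof (induction F rule: free_induct)
  case (elem p)
  show ?case
    by (induction G rule: free_induct) (simp_all add: free_mult_simps free_star_simps star_mult)
qed (simp_all add: free_mult_simps free_star_simps)

lemma free_star_star: "free_star (free_star F) = F"
  by (induction F rule: free_induct) (simp_all add: free_star_simps star_star)

lemma tensor_relationsI:
  "free_elem (d + d', a) - free_elem (d, a) - free_elem (d', a) \<in> tensor_null"
  "free_elem (d, a + a') - free_elem (d, a) - free_elem (d, a') \<in> tensor_null"
  "free_elem (c *\<^sub>C d, a) - c *\<^sub>C free_elem (d, a) \<in> tensor_null"
  "free_elem (d, c *\<^sub>C a) - c *\<^sub>C free_elem (d, a) \<in> tensor_null"
  unfolding tensor_null_def by (rule complex_vector.span_base; unfold tensor_relations_def; blast)+

lemma tensor_null_induct [consumes 1, case_names zero add scale rel]: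
  assumes "F \<in> tensor_null" "P 0" "\<And>F G. P F \<Longrightarrow> P G \<Longrightarrow> P (F + G)" "\<And>c F. P F \<Longrightarrow> P (c *\<^sub>C F)"
    and "\<And>F. F \<in> tensor_relations \<Longrightarrow> P F"
  shows "P F"
  using assms(1) unfolding tensor_null_def
proof (induction rule: complex_vector.span_induct_alt)
  case base
  show ?case by fact
next
  case (step c x y)
  then show ?case using assms by blast
qed

lemma tensor_null_mult_left: "G \<in> tensor_null \<Longrightarrow> free_mult F G \<in> tensor_null"
proof (induction F rule: free_induct)
  case (elem p)
  from elem show ?case
  proof (induction rule: tensor_null_induct)
    case (rel G)
    then show ?case
      unfolding tensor_relations_def
      by (auto simp: free_mult_simps free_mult_diff distrib_left scaleC_mult_right
          intro: tensor_relationsI)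
  qed (simp_all add: free_mult_simps tensor_null_zero tensor_null_add tensor_null_scaleC)
qed (simp_all add: free_mult_simps tensor_null_zero tensor_null_add tensor_null_scaleC)

lemma tensor_null_mult_right: "G \<in> tensor_null \<Longrightarrow> free_mult G F \<in> tensor_null"
proof (induction F rule: free_induct)
  case (elem p)
  from elem show ?case
  proof (induction rule: tensor_null_induct)
    case (rel G)
    then show ?case
      unfolding tensor_relations_def
      by (auto simp: free_mult_simps free_mult_diff distrib_right scaleC_mult_left
          intro: tensor_relationsI)
  qed (simp_all add: free_mult_simps tensor_null_zero tensor_null_add tensor_null_scaleC)
qed (simp_all add: free_mult_simps tensor_null_zero tensor_null_add tensor_null_scaleC)

lemma tensor_null_star: "G \<in> tensor_null \<Longrightarrow> free_star G \<in> tensor_null"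
proof (induction rule: tensor_null_induct)
  case (rel G)
  then show ?case
    unfolding tensor_relations_def
    by (auto simp: free_star_simps star_add star_scaleC intro: tensor_relationsI)
qed (simp_all add: free_star_simps tensor_null_zero tensor_null_add tensor_null_scaleC)

instantiation atensor :: (complex_star_algebra, complex_star_algebra) complex_star_algebra
begin

lift_definition times_atensor :: "('a, 'b) atensor \<Rightarrow> ('a, 'b) atensor \<Rightarrow> ('a, 'b) atensor"
  is free_mult
proof -
  fix F F' G G' :: "'a \<times> 'b \<Rightarrow>\<^sub>0 complex"
  assume "tensor_rel F F'" "tensor_rel G G'"
  then have "free_mult (F - F') G + free_mult F' (G - G') \<in> tensor_null"
    unfolding tensor_rel_def
    by (intro tensor_null_add tensor_null_mult_left tensor_null_mult_right)
  then show "tensor_rel (free_mult F G) (free_mult F' G')"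
    by (simp add: tensor_rel_def free_mult_diff)
qed

lift_definition star_atensor :: "('a, 'b) atensor \<Rightarrow> ('a, 'b) atensor" is free_star
  unfolding tensor_rel_def by (subst free_star_simps(3)[symmetric]) (rule tensor_null_star)

instance
  by standard
    (transfer; simp add: tensor_rel_def tensor_null_zero free_mult_simps free_mult_assoc
      free_star_simps free_star_mult free_star_star)+

end


section \<open>C*-norms and completions\<close>

definition cstar_norm :: "('x::complex_star_algebra \<Rightarrow> real) \<Rightarrow> bool" where
  "cstar_norm \<beta> \<longleftrightarrow>
     (\<forall>x. \<beta> x = 0 \<longleftrightarrow> x = 0) \<and>
     (\<forall>x y. \<beta> (x + y) \<le> \<beta> x + \<beta> y) \<and>
     (\<forall>c x. \<beta> (c *\<^sub>C x) = cmod c * \<beta> x) \<and>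
     (\<forall>x y. \<beta> (x * y) \<le> \<beta> x * \<beta> y) \<and>
     (\<forall>x. \<beta> (star x * x) = (\<beta> x)\<^sup>2)"

text \<open>\<open>cstar_completion \<beta> \<iota>\<close>: the codomain of \<open>\<iota>\<close>, a C*-algebra and hence complete, is the
  completion of its domain in the norm \<open>\<beta>\<close>, with \<open>\<iota>\<close> the canonical embedding.  This
  determines the codomain up to a unique isometric star-isomorphism compatible with
  \<open>\<iota>\<close>.\<close>

definition cstar_completion ::
    "('x::complex_star_algebra \<Rightarrow> real) \<Rightarrow> ('x \<Rightarrow> 'e::cstar_algebra) \<Rightarrow> bool" where
  "cstar_completion \<beta> \<iota> \<longleftrightarrow> star_hom \<iota> \<and> (\<forall>x. norm (\<iota> x) = \<beta> x) \<and> closure (range \<iota>) = UNIV"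

end

theory Submission
  imports Defs "HOL-Computational_Algebra.Fundamental_Theorem_Algebra"
begin

text \<open>
  Write \<open>K\<close> for the set of all \<open>a\<close> in a C*-algebra such that \<open>a e = a\<close> for some \<open>e\<close>.  The proof
  rests on the following description: the Pedersen ideal is the ideal generated by \<open>K\<close>
  (\<open>pedersen_ideal_eq\<close>).  On the one hand every dense ideal contains \<open>K\<close>, by inverting an element
  close to \<open>1\<close> (\<open>dense_ideal_contains\<close>).  On the other hand an ideal containing \<open>K\<close> is dense,
  because a self-adjoint element is approximated by its soft thresholds, which lie in \<open>K\<close>
  (\<open>selfadjoint_approx\<close>).

  Suppose that \<open>f\<close> has a right unit \<open>e\<close> and a left unit \<open>e'\<close>, that is, \<open>f e = f = e' f\<close>.  The
  \<open>a\<close> for which \<open>\<rho>(f \<otimes> a)\<close> lies in the Pedersen ideal of the target then form an ideal, as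
  \<open>f \<otimes> x a y = (e' \<otimes> x) (f \<otimes> a) (e \<otimes> y)\<close>.  This ideal contains \<open>K\<close>, because \<open>a u = a\<close> implies
  \<open>(f \<otimes> a) (e \<otimes> u) = f \<otimes> a\<close>.  Hence it contains the Pedersen ideal
  (\<open>slice_maps_pedersen_ideal\<close>).

  It remains to find units.  A compact element has a self-adjoint one by definition.  If \<open>0\<close> is
  isolated in the spectrum of \<open>\<bar>f\<bar>\<close>, then the range projection of \<open>\<bar>f\<bar>\<close> is a continuous function
  of \<open>\<bar>f\<bar>\<close>; it is a right unit for \<open>f\<close>, and it yields a left unit (\<open>isolated_zero_imp_units\<close>).

  The analytic input is the continuous functional calculus of a self-adjoint element \<open>x\<close>, together
  with the existence and uniqueness of \<open>\<bar>f\<bar>\<close>.  The bound \<open>\<parallel>p(x)\<parallel> \<le> sup \<bar>p\<bar>\<close> over the spectrum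
  (\<open>norm_aev_le\<close>) combines the spectral mapping theorem with the fact that the norm of a
  self-adjoint element is attained on its spectrum; the latter comes from an averaging argument for
  resolvents (\<open>exists_noninvertible_on_circle\<close>).  Functions are limits of polynomials without
  constant term (\<open>ex_is_cfc\<close>).  Positivity of \<open>f\<^sup>* f\<close> (\<open>positive_star_mult_self\<close>) needs that sums of
  positive elements are positive, which follows from bounds for multiplication operators
  (\<open>uspec_shift_bound\<close>, \<open>positive_shift_bound\<close>).
\<close>

section \<open>Elementary facts on C*-algebras\<close>

lemma star_zero [simp]: "star (0 :: 'a::complex_star_algebra) = 0"
  using star_scaleC[of 0 "0 :: 'a"] by simp

lemma star_uminus: "star (- x) = - star (x :: 'a::complex_star_algebra)"
  using star_add[of x "- x"] by (simp add: eq_neg_iff_add_eq_0 add.commute)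

lemma star_diff: "star (x - y) = star x - star (y :: 'a::complex_star_algebra)"
  using star_add[of x "- y"] by (simp add: star_uminus)

lemma norm_star [simp]: "norm (star x) = norm (x :: 'a::cstar_algebra)"
proof -
  have le: "norm y \<le> norm (star y)" for y :: 'a
  proof (cases "norm y = 0")
    case False
    have "norm y * norm y \<le> norm (star y) * norm y"
      using norm_mult_ineq[of "star y" y] by (simp add: cstar_identity power2_eq_square)
    with False show ?thesis by simp
  qed simp
  show ?thesis
    using le[of x] le[of "star x"] by (simp add: star_star)
qed

lemma star_mult_self_eq_zero_iff [simp]: "star x * x = 0 \<longleftrightarrow> x = (0 :: 'a::cstar_algebra)"
  using cstar_identity[of x] by auto

lemma norm_square_selfadjoint:
  "star x = x \<Longrightarrow> norm (x * x) = (norm (x :: 'a::cstar_algebra))\<^sup>2"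
  using cstar_identity[of x] by simp

lemma tendsto_star: "(f \<longlongrightarrow> l) F \<Longrightarrow> ((\<lambda>n. star (f n)) \<longlongrightarrow> star (l :: 'a::cstar_algebra)) F"
  by (simp add: tendsto_iff dist_norm flip: star_diff)

section \<open>The unitization\<close>

text \<open>The unitization as a type, so that the arithmetic of rings with unit and of Banach algebras
  becomes available; the datatype only renames the pairs \<open>(x, a)\<close>.  The norm
  \<open>\<parallel>x\<parallel> + \<bar>a\<bar>\<close> is complete and submultiplicative, but in general not a C*-norm: the
  C*-identity will only be used for elements of the algebra itself.\<close>

datatype 'a unitization = Adj (vec: 'a) (sca: complex)

instantiation unitization :: (complex_star_algebra) ring_1
begin
definition "0 = Adj 0 0"
definition "1 = Adj 0 1"
definition "u + v = Adj (vec u + vec v) (sca u + sca v)"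
definition "u - v = Adj (vec u - vec v) (sca u - sca v)"
definition "- u = Adj (- vec u) (- sca u)"
definition "u * v =
  Adj (vec u * vec v + sca u *\<^sub>C vec v + sca v *\<^sub>C vec u) (sca u * sca v)"
instance
  by standard
    (auto intro!: unitization.expand simp: zero_unitization_def one_unitization_def
      plus_unitization_def minus_unitization_def uminus_unitization_def times_unitization_def
      algebra_simps scaleC_add_right scaleC_add_left scaleC_scaleC scaleC_one
      scaleC_mult_left scaleC_mult_right)
end

lemma vec_sca_simps [simp]:
  fixes u v :: "'a::complex_star_algebra unitization"
  shows "vec (0 :: 'a unitization) = 0" "sca (0 :: 'a unitization) = 0"
    "vec (1 :: 'a unitization) = 0" "sca (1 :: 'a unitization) = 1"
    "vec (u + v) = vec u + vec v" "sca (u + v) = sca u + sca v"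
    "vec (u - v) = vec u - vec v" "sca (u - v) = sca u - sca v"
    "vec (- u) = - vec u" "sca (- u) = - sca u"
    "vec (u * v) = vec u * vec v + sca u *\<^sub>C vec v + sca v *\<^sub>C vec u"
    "sca (u * v) = sca u * sca v"
  by (simp_all add: zero_unitization_def one_unitization_def plus_unitization_def
      minus_unitization_def uminus_unitization_def times_unitization_def)

instantiation unitization :: (cstar_algebra) real_normed_algebra_1
begin
definition "norm u = norm (vec u) + cmod (sca u)"
definition "r *\<^sub>R u = Adj (r *\<^sub>R vec u) (r *\<^sub>R sca u)"
definition "dist u v = norm (u - v :: 'a unitization)"
definition "sgn u = inverse (norm u) *\<^sub>R (u :: 'a unitization)"
definition "uniformity =
  (INF e\<in>{0<..}. principal {(u, v :: 'a unitization). dist u v < e})"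
definition "open U \<longleftrightarrow>
  (\<forall>u\<in>U. \<forall>\<^sub>F (u', v) in uniformity. u' = u \<longrightarrow> (v :: 'a unitization) \<in> U)"
instance
proof
  fix u v :: "'a unitization" and r s :: real
  show "dist u v = norm (u - v)" "sgn u = inverse (norm u) *\<^sub>R u"
    "(uniformity :: ('a unitization \<times> 'a unitization) filter) =
       (INF e\<in>{0<..}. principal {(x, y). dist x y < e})"
    by (rule dist_unitization_def sgn_unitization_def uniformity_unitization_def)+
  show "open U \<longleftrightarrow> (\<forall>x\<in>U. \<forall>\<^sub>F (x', y) in uniformity. x' = x \<longrightarrow> y \<in> U)"
    for U :: "'a unitization set"
    by (rule open_unitization_def)
  show "r *\<^sub>R (u + v) = r *\<^sub>R u + r *\<^sub>R v" "(r + s) *\<^sub>R u = r *\<^sub>R u + s *\<^sub>R u"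
    "r *\<^sub>R s *\<^sub>R u = (r * s) *\<^sub>R u" "1 *\<^sub>R u = u"
    by (auto intro!: unitization.expand simp: scaleR_unitization_def algebra_simps)
  show "r *\<^sub>R u * v = r *\<^sub>R (u * v)" "u * r *\<^sub>R v = r *\<^sub>R (u * v)"
    by (rule unitization.expand;
        simp add: scaleR_unitization_def scaleR_scaleC scaleC_scaleC scaleC_mult_left
          scaleC_mult_right scaleC_add_right scaleR_conv_of_real ac_simps)+
  show "norm u = 0 \<longleftrightarrow> u = 0"
    by (cases u) (auto simp: norm_unitization_def zero_unitization_def add_nonneg_eq_0_iff)
  show "norm (u + v) \<le> norm u + norm v"
    using norm_triangle_ineq[of "vec u" "vec v"] norm_triangle_ineq[of "sca u" "sca v"]
    by (simp add: norm_unitization_def)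
  show "norm (r *\<^sub>R u) = \<bar>r\<bar> * norm u"
    by (simp add: norm_unitization_def scaleR_unitization_def algebra_simps)
  show "norm (u * v) \<le> norm u * norm v"
  proof -
    have "norm (vec (u * v)) \<le>
        norm (vec u * vec v) + norm (sca u *\<^sub>C vec v) + norm (sca v *\<^sub>C vec u)"
      by (simp add: norm_triangle_le)
    also have "\<dots> \<le> norm (vec u) * norm (vec v) + cmod (sca u) * norm (vec v)
        + cmod (sca v) * norm (vec u)"
      by (simp add: norm_scaleC norm_mult_ineq)
    finally show ?thesis
      by (simp add: norm_unitization_def algebra_simps norm_mult)
  qed
  show "norm (1 :: 'a unitization) = 1"
    by (simp add: norm_unitization_def)
qed
end

lemma bounded_linear_vec: "bounded_linear (vec :: 'a::cstar_algebra unitization \<Rightarrow> 'a)"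
  by (rule bounded_linear_intro[of _ 1]) (simp_all add: norm_unitization_def scaleR_unitization_def)

lemma bounded_linear_sca: "bounded_linear (sca :: 'a::cstar_algebra unitization \<Rightarrow> complex)"
  by (rule bounded_linear_intro[of _ 1]) (simp_all add: norm_unitization_def scaleR_unitization_def)

instance unitization :: (cstar_algebra) banach
proof
  fix X :: "nat \<Rightarrow> 'a unitization"
  assume X: "Cauchy X"
  have "Cauchy (\<lambda>n. vec (X n))" "Cauchy (\<lambda>n. sca (X n))"
    using bounded_linear.Cauchy[OF bounded_linear_vec X]
      bounded_linear.Cauchy[OF bounded_linear_sca X] by simp_all
  then obtain x c where lim: "(\<lambda>n. vec (X n)) \<longlonglongrightarrow> x" "(\<lambda>n. sca (X n)) \<longlonglongrightarrow> c"
    unfolding Cauchy_convergent_iff convergent_def by blast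
  have "(\<lambda>n. norm (vec (X n) - x) + cmod (sca (X n) - c)) \<longlonglongrightarrow> 0 + 0"
    using lim by (intro tendsto_add tendsto_norm_zero) (simp_all add: LIM_zero)
  then have "(\<lambda>n. norm (X n - Adj x c)) \<longlonglongrightarrow> 0"
    by (simp add: norm_unitization_def)
  then have "X \<longlonglongrightarrow> Adj x c"
    by (simp add: tendsto_norm_zero_iff LIM_zero_iff)
  then show "convergent X"
    by (rule convergentI)
qed

definition emb :: "'a::complex_star_algebra \<Rightarrow> 'a unitization" where "emb x = Adj x 0"

definition usc :: "complex \<Rightarrow> 'a::complex_star_algebra unitization" where "usc c = Adj 0 c"

lemma vec_sca_emb_usc [simp]: "vec (emb x) = x" "sca (emb x) = 0" "vec (usc c) = 0" "sca (usc c) = c"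
  by (simp_all add: emb_def usc_def)

lemma usc_simps: "usc 0 = 0" "usc 1 = 1" "usc (a + b) = usc a + usc b"
  "usc (a - b) = usc a - usc b" "usc (- a) = - usc a" "usc (a * b) = usc a * usc b"
  by (rule unitization.expand; simp)+

lemma emb_simps: "emb 0 = 0" "emb (x + y) = emb x + emb y" "emb (x - y) = emb x - emb y"
  "emb (- x) = - emb x" "emb (x * y) = emb x * emb y" "emb (c *\<^sub>C x) = usc c * emb x"
  by (rule unitization.expand; simp)+

lemma emb_inject [simp]: "emb x = emb y \<longleftrightarrow> x = y"
  by (simp add: emb_def)

lemma usc_commute: "usc c * u = u * usc c"
  by (rule unitization.expand) (simp add: mult.commute)

lemma norm_emb [simp]: "norm (emb x) = norm (x :: 'a::cstar_algebra)"
  by (simp add: norm_unitization_def)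

lemma norm_usc_mult [simp]: "norm (usc c * u) = cmod c * norm (u :: 'a::cstar_algebra unitization)"
  by (simp add: norm_unitization_def norm_scaleC norm_mult algebra_simps)

section \<open>Invertible elements\<close>

definition invertible_elt :: "'r::ring_1 \<Rightarrow> bool" where
  "invertible_elt u \<longleftrightarrow> (\<exists>v. u * v = 1 \<and> v * u = 1)"

lemma invertible_elt_mult:
  assumes "invertible_elt u" "invertible_elt v"
  shows "invertible_elt (u * v)"
proof -
  obtain u' v' where "u * u' = 1" "u' * u = 1" "v * v' = 1" "v' * v = 1"
    using assms by (auto simp: invertible_elt_def)
  then have "u * (v * v') * u' = 1" "v' * (u' * u) * v = 1"
    by simp_all
  then have "u * v * (v' * u') = 1" "v' * u' * (u * v) = 1"
    by (simp_all add: mult.assoc)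
  then show ?thesis unfolding invertible_elt_def by blast
qed

lemma invertible_elt_factor:
  assumes "invertible_elt (u * v)" "u * v = v * u"
  shows "invertible_elt u"
proof -
  obtain w where w: "u * v * w = 1" "w * (u * v) = 1"
    using assms by (auto simp: invertible_elt_def)
  \<comment> \<open>A left and a right inverse coincide.\<close>
  have "v * w = (w * v * u) * (v * w)"
    using w assms(2) by (simp add: mult.assoc)
  also have "\<dots> = w * v"
    using w by (simp add: mult.assoc)
  finally have "v * w = w * v" .
  then have "v * w * u = 1"
    using w(2) assms(2) by (simp add: mult.assoc)
  moreover have "u * (v * w) = 1"
    using w(1) by (simp add: mult.assoc)
  ultimately show ?thesis
    unfolding invertible_elt_def by blast
qed

text \<open>Jacobson's lemma: if \<open>w\<close> inverts \<open>1 - u v\<close> then \<open>1 + v w u\<close> inverts \<open>1 - v u\<close>.\<close>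

lemma invertible_elt_one_minus_swap:
  assumes "invertible_elt (1 - u * v)"
  shows "invertible_elt (1 - v * u)"
proof -
  obtain w where w: "(1 - u * v) * w = 1" "w * (1 - u * v) = 1"
    using assms by (auto simp: invertible_elt_def)
  have "(1 - v * u) * (1 + v * w * u) = 1 - v * u + v * ((1 - u * v) * w) * u"
    by (simp add: algebra_simps)
  moreover have "(1 + v * w * u) * (1 - v * u) = 1 - v * u + v * (w * (1 - u * v)) * u"
    by (simp add: algebra_simps)
  ultimately show ?thesis
    unfolding invertible_elt_def using w by (intro exI[of _ "1 + v * w * u"]) simp
qed

lemma invertible_elt_one_minus:
  fixes w :: "'r::{real_normed_algebra_1,banach}"
  assumes "norm w < 1"
  shows "invertible_elt (1 - w)"
proof -
  have sm: "summable (\<lambda>n. w ^ n)"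
    using assms by (rule complete_algebra_summable_geometric)
  define v where "v = suminf (\<lambda>n. w ^ n)"
  have "w * v = suminf (\<lambda>n. w ^ Suc n)"
    unfolding v_def power_Suc by (rule suminf_mult[OF sm, symmetric])
  moreover have "v * w = suminf (\<lambda>n. w ^ Suc n)"
    unfolding v_def power_Suc2 by (rule suminf_mult2[OF sm])
  moreover have "suminf (\<lambda>n. w ^ Suc n) = v - 1"
    unfolding v_def using suminf_split_head[OF sm] by (simp only: power_0)
  ultimately have "w * v = v - 1" "v * w = v - 1"
    by (simp_all only:)
  then have "(1 - w) * v = 1" "v * (1 - w) = 1"
    unfolding left_diff_distrib right_diff_distrib by simp_all
  then show ?thesis
    unfolding invertible_elt_def by blast
qed

section \<open>Polynomials in an element\<close>

definition upoly :: "complex poly \<Rightarrow> 'a::complex_star_algebra unitization \<Rightarrow> 'a unitization" where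
  "upoly p u = fold_coeffs (\<lambda>c v. usc c + u * v) p 0"

lemma upoly_0 [simp]: "upoly 0 u = 0"
  by (simp add: upoly_def)

lemma upoly_pCons [simp]: "upoly (pCons c p) u = usc c + u * upoly p u"
  by (cases "p = 0 \<and> c = 0") (auto simp: upoly_def usc_simps)

lemma upoly_add: "upoly (p + q) u = upoly p u + upoly q u"
  by (induction p q rule: poly_induct2) (simp_all add: usc_simps algebra_simps)

lemma upoly_smult: "upoly (smult c p) u = usc c * upoly p u"
proof (induction p)
  case (pCons a p)
  have "u * (usc c * upoly p u) = usc c * (u * upoly p u)"
    by (simp only: usc_commute mult.assoc)
  then show ?case
    using pCons by (simp add: usc_simps distrib_left)
qed simp

lemma upoly_mult: "upoly (p * q) u = upoly p u * upoly q u"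
  by (induction p) (simp_all add: upoly_add upoly_smult usc_simps distrib_right mult.assoc)

lemma upoly_diff: "upoly (p - q) u = upoly p u - upoly q u"
  using upoly_add[of "p - q" q u] by simp

lemma upoly_commute: "upoly p u * upoly q u = upoly q u * upoly p u"
  by (simp add: mult.commute flip: upoly_mult)

lemma upoly_1 [simp]: "upoly 1 u = 1"
  by (simp add: one_pCons usc_simps)

lemma sca_upoly [simp]: "sca (upoly p u) = poly p (sca u)"
  by (induction p) simp_all

text \<open>The value \<open>p(x)\<close> lies in \<open>p(0) 1 + A\<close>, where \<open>A\<close> is the algebra of \<open>x\<close>, so that the projection
  to \<open>A\<close> loses nothing for polynomials without constant term.\<close>

definition aev :: "complex poly \<Rightarrow> 'a::complex_star_algebra \<Rightarrow> 'a" where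
  "aev p x = vec (upoly p (emb x))"

lemma emb_aev: "poly p 0 = 0 \<Longrightarrow> emb (aev p x) = upoly p (emb x)"
  by (rule unitization.expand) (simp add: aev_def)

lemma aev_add: "aev (p + q) x = aev p x + aev q x"
  and aev_diff: "aev (p - q) x = aev p x - aev q x"
  by (simp_all add: aev_def upoly_add upoly_diff)

lemma aev_mult: "poly p 0 = 0 \<Longrightarrow> poly q 0 = 0 \<Longrightarrow> aev (p * q) x = aev p x * aev q x"
  by (simp add: aev_def upoly_mult)

lemma aev_X: "aev [:0, 1:] x = x"
  by (simp add: aev_def usc_simps scaleC_one)

lemma aev_mult_linear: "poly p 0 = 0 \<Longrightarrow> aev ([:c, 1:] * p) x = x * aev p x + c *\<^sub>C aev p x"
  unfolding aev_def upoly_mult by (simp add: usc_simps scaleC_one)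

lemma aev_pCons: "aev (pCons c p) x = x * aev p x + poly p 0 *\<^sub>C x"
  by (simp add: aev_def)

lemma aev_commute: "x * aev p x = aev p x * x"
proof -
  have "vec (upoly p (emb x) * upoly [:0, 1:] (emb x)) = vec (upoly [:0, 1:] (emb x) * upoly p (emb x))"
    by (simp only: upoly_commute)
  then show ?thesis
    by (simp add: aev_def usc_simps)
qed

lemma star_aev:
  assumes "star x = x"
  shows "star (aev p x) = aev (map_poly cnj p) x"
proof (induction p)
  case 0
  show ?case by (simp add: aev_def)
next
  case (pCons c p)
  have "poly (map_poly cnj p) 0 = cnj (poly p 0)"
    by (simp add: poly_0_coeff_0 coeff_map_poly)
  with pCons assms show ?case
    by (simp add: map_poly_pCons aev_pCons star_add star_mult star_scaleC aev_commute)
qed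

section \<open>The spectrum\<close>

text \<open>The spectrum computed in the unitization, whether or not the algebra has a unit. It
  differs from the spectrum at most by the point \<open>0\<close>, which it always contains.\<close>

definition uspec :: "'a::complex_star_algebra \<Rightarrow> complex set" where
  "uspec x = {z. \<not> invertible_elt (emb x - usc z)}"

lemma zero_in_uspec [simp]: "0 \<in> uspec x"
proof -
  have "(emb x - usc 0) * v \<noteq> 1" for v
  proof
    assume "(emb x - usc 0) * v = 1"
    then have "sca ((emb x - usc 0) * v) = sca (1 :: 'a unitization)" by (simp only:)
    then show False by simp
  qed
  then show ?thesis
    by (simp add: uspec_def invertible_elt_def)
qed

lemma unitization_invertible_iff: "unitization_invertible (x, c) \<longleftrightarrow> invertible_elt (emb x + usc c)"
proof -
  have eq: "unitization_mult (a, s) (b, t) = (0, 1) \<longleftrightarrow> (emb a + usc s) * (emb b + usc t) = 1"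
    for a b :: 'a and s t
    by (auto simp: unitization_mult_def times_unitization_def one_unitization_def)
  have "emb (vec v) + usc (sca v) = v" for v :: "'a unitization"
    by (rule unitization.expand) simp
  then show ?thesis
    unfolding unitization_invertible_def invertible_elt_def
    by (metis eq surj_pair)
qed

lemma uspec_eq: "uspec x = insert 0 (spectrum (x :: 'a::complex_star_algebra))"
proof (cases "\<exists>u::'a. is_unit_element u")
  case False
  then have "spectrum x = uspec x"
    unfolding spectrum_def uspec_def if_not_P[OF False]
    by (simp add: unitization_invertible_iff usc_simps)
  then show ?thesis by (simp add: insert_absorb)
next
  case True
  then obtain u :: 'a where u: "is_unit_element u" by blast
  have unit: "u * y = y" "y * u = y" for y
    using u by (auto simp: is_unit_element_def)
  have uniq: "is_unit_element v \<longleftrightarrow> v = u" for v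
    using u unfolding is_unit_element_def by metis
  have "invertible_elt (emb x - usc z) \<longleftrightarrow> (\<exists>y. (x - z *\<^sub>C u) * y = u \<and> y * (x - z *\<^sub>C u) = u)"
    if z: "z \<noteq> 0" for z
  proof
    assume "invertible_elt (emb x - usc z)"
    then obtain v where v: "(emb x - usc z) * v = 1" "v * (emb x - usc z) = 1"
      unfolding invertible_elt_def by blast
    let ?y = "vec v + sca v *\<^sub>C u"
    have "sca ((emb x - usc z) * v) = 1" "vec ((emb x - usc z) * v) = 0"
      "vec (v * (emb x - usc z)) = 0"
      by (simp_all only: v vec_sca_simps)
    then have "- z * sca v = 1" "x * vec v - z *\<^sub>C vec v + sca v *\<^sub>C x = 0"
      "vec v * x - z *\<^sub>C vec v + sca v *\<^sub>C x = 0"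
      by (simp_all add: algebra_simps)
    moreover have "(x - z *\<^sub>C u) * ?y = (x * vec v - z *\<^sub>C vec v + sca v *\<^sub>C x) + (- z * sca v) *\<^sub>C u"
      "?y * (x - z *\<^sub>C u) = (vec v * x - z *\<^sub>C vec v + sca v *\<^sub>C x) + (- z * sca v) *\<^sub>C u"
      by (simp_all add: algebra_simps unit scaleC_mult_left scaleC_mult_right scaleC_scaleC)
    ultimately have "(x - z *\<^sub>C u) * ?y = u \<and> ?y * (x - z *\<^sub>C u) = u"
      by (simp only: add_0_left scaleC_one)
    then show "\<exists>y. (x - z *\<^sub>C u) * y = u \<and> y * (x - z *\<^sub>C u) = u" by blast
  next
    assume "\<exists>y. (x - z *\<^sub>C u) * y = u \<and> y * (x - z *\<^sub>C u) = u"
    then obtain y where y: "(x - z *\<^sub>C u) * y = u" "y * (x - z *\<^sub>C u) = u" by blast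
    have y': "x * y = u + z *\<^sub>C y" "y * x = u + z *\<^sub>C y"
      using y by (simp_all add: algebra_simps unit scaleC_mult_left scaleC_mult_right)
    let ?v = "Adj (y + inverse z *\<^sub>C u) (- inverse z)"
    have "(emb x - usc z) * ?v = 1" "?v * (emb x - usc z) = 1"
      by (rule unitization.expand; use z in \<open>simp add: distrib_left distrib_right unit y'
          scaleC_mult_left scaleC_mult_right scaleC_add_right scaleC_scaleC scaleC_one\<close>)+
    then show "invertible_elt (emb x - usc z)"
      unfolding invertible_elt_def by blast
  qed
  then have *: "z \<in> uspec x \<longleftrightarrow> z \<in> spectrum x" if "z \<noteq> 0" for z
    using that True by (simp add: uspec_def spectrum_def uniq)
  show ?thesis
  proof (rule set_eqI)
    show "z \<in> uspec x \<longleftrightarrow> z \<in> insert 0 (spectrum x)" for z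
      by (cases "z = 0") (simp_all add: *)
  qed
qed

lemma invertible_usc: "c \<noteq> 0 \<Longrightarrow> invertible_elt (usc c)"
  unfolding invertible_elt_def
  by (intro exI[of _ "usc (inverse c)"]) (simp flip: usc_simps)

lemma not_invertible_upoly:
  assumes "z \<in> uspec x"
  shows "\<not> invertible_elt (upoly p (emb x) - usc (poly p z))"
proof
  assume inv: "invertible_elt (upoly p (emb x) - usc (poly p z))"
  obtain r where r: "p - [:poly p z:] = [:- z, 1:] * r"
    using poly_eq_0_iff_dvd[of "p - [:poly p z:]" z] by auto
  have "upoly p (emb x) - usc (poly p z) = upoly (p - [:poly p z:]) (emb x)"
    by (simp add: upoly_diff)
  then have "invertible_elt (upoly [:- z, 1:] (emb x) * upoly r (emb x))"
    using inv by (simp only: r upoly_mult)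
  from invertible_elt_factor[OF this upoly_commute] assms show False
    by (simp add: uspec_def usc_simps)
qed

lemma poly_in_uspec_aev: "poly p 0 = 0 \<Longrightarrow> z \<in> uspec x \<Longrightarrow> poly p z \<in> uspec (aev p x)"
  using not_invertible_upoly[of z x p] by (simp add: uspec_def[of "aev p x"] emb_aev)

text \<open>The fundamental theorem of algebra splits the polynomial into linear factors, each of which
  is invertible at \<open>x\<close>.\<close>

lemma invertible_upoly:
  assumes "p \<noteq> 0" "\<And>z. poly p z = 0 \<Longrightarrow> z \<notin> uspec x"
  shows "invertible_elt (upoly p (emb x))"
  using assms
proof (induction "degree p" arbitrary: p)
  case 0
  then obtain c where "p = [:c:]" by (metis degree_eq_zeroE)
  with 0 show ?case by (simp add: invertible_usc)
next
  case (Suc n)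
  then have "\<not> constant (poly p)" by (simp add: constant_degree)
  then obtain z where z: "poly p z = 0" using fundamental_theorem_of_algebra by blast
  then obtain q where q: "p = [:- z, 1:] * q" unfolding poly_eq_0_iff_dvd by blast
  with Suc.prems have "q \<noteq> 0" by auto
  then have "degree p = Suc (degree q)"
    unfolding q by (subst degree_mult_eq) auto
  with Suc q \<open>q \<noteq> 0\<close> have "invertible_elt (upoly q (emb x))" by simp
  moreover have "invertible_elt (upoly [:- z, 1:] (emb x))"
    using Suc.prems(2)[OF z] by (simp add: uspec_def usc_simps)
  ultimately show ?case
    unfolding q upoly_mult by (rule invertible_elt_mult[rotated])
qed

lemma uspec_aevE:
  assumes "w \<in> uspec (aev p x)" "poly p 0 = 0"
  obtains z where "z \<in> uspec x" "w = poly p z"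
proof (cases "p = [:w:]")
  case True
  with assms(2) that[of 0] show ?thesis by simp
next
  case False
  have "\<not> invertible_elt (upoly (p - [:w:]) (emb x))"
    using assms by (simp add: uspec_def emb_aev upoly_diff)
  with False invertible_upoly[of "p - [:w:]" x] that show ?thesis by auto
qed

text \<open>\<open>x y - z\<close> is \<open>- z\<close> times \<open>1 - (x / z) y\<close>, to which Jacobson's lemma applies.\<close>

lemma uspec_mult_commute_le: "uspec (x * y) \<subseteq> uspec (y * x)"
proof
  fix z assume z: "z \<in> uspec (x * y)"
  show "z \<in> uspec (y * x)"
  proof (cases "z = 0")
    case False
    let ?u = "usc (inverse z) * emb x"
    have "emb (x * y) - usc z = usc (- z) * (1 - ?u * emb y)"
      using False by (auto intro!: unitization.expand
          simp: algebra_simps scaleC_mult_left scaleC_scaleC scaleC_one)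
    moreover have *: "1 - emb y * ?u = usc (- inverse z) * (emb (y * x) - usc z)"
      using False by (auto intro!: unitization.expand
          simp: algebra_simps scaleC_mult_right scaleC_scaleC scaleC_one)
    ultimately show ?thesis
      using z False invertible_elt_one_minus_swap[of "emb y" ?u]
        invertible_elt_mult[of "usc (- z)" "1 - ?u * emb y"]
        invertible_elt_mult[of "usc (- inverse z)" "emb (y * x) - usc z"]
      by (auto simp: uspec_def invertible_usc)
  qed simp
qed

lemma uspec_mult_commute: "uspec (x * y) = uspec (y * x)"
  by (intro equalityI uspec_mult_commute_le)

lemma norm_uspec_le:
  assumes "z \<in> uspec x"
  shows "cmod z \<le> norm (x :: 'a::cstar_algebra)"
proof (rule ccontr)
  assume less: "\<not> cmod z \<le> norm x"
  then have "z \<noteq> 0" by auto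
  then have "emb x - usc z = usc (- z) * (1 - usc (inverse z) * emb x)"
    by (auto intro!: unitization.expand simp: algebra_simps scaleC_scaleC scaleC_one)
  moreover have "norm (usc (inverse z) * emb x) = norm x / cmod z"
    by (simp only: norm_usc_mult norm_emb norm_inverse divide_inverse mult.commute)
  then have "norm (usc (inverse z) * emb x) < 1"
    using less \<open>z \<noteq> 0\<close> by (simp only: divide_less_eq_1 zero_less_norm_iff) simp
  then have "invertible_elt (usc (- z) * (1 - usc (inverse z) * emb x))"
    using \<open>z \<noteq> 0\<close> by (intro invertible_elt_mult invertible_usc invertible_elt_one_minus) simp_all
  ultimately show False
    using assms by (simp only: uspec_def mem_Collect_eq simp_thms)
qed

section \<open>Spectrum and norm of a self-adjoint element\<close>

lemma le_if_power_le:
  fixes a b q M :: real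
  assumes "0 < a" "0 \<le> M" "\<And>n. a * q ^ n \<le> b * M ^ n"
  shows "q \<le> M"
proof (rule ccontr)
  assume "\<not> q \<le> M"
  then have q: "M < q" "0 < q" using assms by auto
  have "(\<lambda>n. b * (M / q) ^ n) \<longlonglongrightarrow> b * 0"
    using q assms by (intro tendsto_mult tendsto_const LIMSEQ_realpow_zero) auto
  moreover have "a \<le> b * (M / q) ^ n" for n
    using assms(3)[of n] q by (simp add: power_divide field_simps)
  ultimately have "a \<le> b * 0"
    by (intro LIMSEQ_le_const) auto
  with assms show False by simp
qed

text \<open>A bound for \<open>x + c\<close> as a multiplication operator on the algebra bounds the spectrum of
  \<open>x + c\<close>: the polynomials \<open>x (x + c)\<^sup>n\<close>, which lie in the algebra, have norm at most
  \<open>M\<^sup>n \<parallel>x\<parallel>\<close>, so that \<open>\<bar>z\<bar> \<bar>z + c\<bar>\<^sup>n \<le> M\<^sup>n \<parallel>x\<parallel>\<close> for all \<open>n\<close>.  This does the work of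
  the C*-norm of the unitization.\<close>

lemma uspec_shift_bound:
  fixes x :: "'a::cstar_algebra"
  assumes "\<And>y. norm (x * y + c *\<^sub>C y) \<le> M * norm y" "0 \<le> M" "z \<in> uspec x" "z \<noteq> 0"
  shows "cmod (z + c) \<le> M"
proof (rule le_if_power_le)
  show "0 < cmod z" "0 \<le> M" using assms by auto
  fix n
  let ?p = "\<lambda>n. [:c, 1:] ^ n * [:0, 1:]"
  have p0: "poly (?p n) 0 = 0" for n by simp
  have "norm (aev (?p n) x) \<le> M ^ n * norm x" for n
  proof (induction n)
    case 0
    show ?case by (simp add: aev_X)
  next
    case (Suc n)
    have "norm (aev (?p (Suc n)) x) \<le> M * norm (aev (?p n) x)"
      using assms(1)[of "aev (?p n) x"] p0[of n] by (simp only: power_Suc mult.assoc aev_mult_linear)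
    also have "\<dots> \<le> M * (M ^ n * norm x)"
      using Suc assms(2) by (rule mult_left_mono)
    finally show ?case by (simp add: mult.assoc)
  qed
  moreover have "cmod (poly (?p n) z) \<le> norm (aev (?p n) x)"
    using assms(3) p0 by (intro norm_uspec_le poly_in_uspec_aev)
  ultimately show "cmod z * cmod (z + c) ^ n \<le> norm x * M ^ n"
    by (simp add: norm_mult norm_power mult.commute add.commute order_trans)
qed

text \<open>For real \<open>s\<close> the operator \<open>x + i s\<close> has norm at most \<open>sqrt (\<parallel>x\<parallel>\<^sup>2 + s\<^sup>2)\<close>; a non-real
  spectral value would violate the resulting bound for large \<open>s\<close>.\<close>

lemma uspec_selfadjoint_real:
  fixes x :: "'a::cstar_algebra"
  assumes x: "star x = x" and z: "z \<in> uspec x"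
  shows "Im z = 0"
proof (rule ccontr)
  assume Im: "Im z \<noteq> 0"
  \<comment> \<open>Chosen so that \<open>\<bar>z + i s\<bar>\<^sup>2 - s\<^sup>2 = \<bar>z\<bar>\<^sup>2 + 2 s Im z\<close> exceeds \<open>\<parallel>x\<parallel>\<^sup>2\<close>.\<close>
  define s where "s = ((norm x)\<^sup>2 + 1) / (2 * Im z)"
  define c where "c = \<i> * complex_of_real s"
  have "norm (x * y + c *\<^sub>C y) \<le> sqrt ((norm x)\<^sup>2 + s\<^sup>2) * norm y" for y
  proof -
    have cc: "c * c = - complex_of_real (s\<^sup>2)" "cnj c = - c"
      by (simp_all add: c_def complex_eq_iff power2_eq_square)
    have "star (x * y + c *\<^sub>C y) * (x * y + c *\<^sub>C y) =
        star y * (x * (x * y)) + (c *\<^sub>C (star y * (x * y)) + cnj c *\<^sub>C (star y * (x * y)))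
          + (cnj c * c) *\<^sub>C (star y * y)"
      by (simp add: star_add star_mult star_scaleC x distrib_left distrib_right scaleC_mult_left
          scaleC_mult_right scaleC_scaleC scaleC_add_right mult.assoc mult.commute[of "cnj c"])
    also have "\<dots> = star y * (x * (x * y) + complex_of_real (s\<^sup>2) *\<^sub>C y)"
      by (simp add: cc distrib_left scaleC_mult_right)
    finally have "(norm (x * y + c *\<^sub>C y))\<^sup>2 =
        norm (star y * (x * (x * y) + complex_of_real (s\<^sup>2) *\<^sub>C y))"
      by (simp flip: cstar_identity)
    also have "\<dots> \<le> norm (star y) * norm (x * (x * y) + complex_of_real (s\<^sup>2) *\<^sub>C y)"
      by (rule norm_mult_ineq)
    also have "\<dots> \<le> norm y * (norm x * (norm x * norm y) + s\<^sup>2 * norm y)"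
    proof -
      have "norm (x * (x * y)) \<le> norm x * (norm x * norm y)"
        by (meson norm_ge_zero norm_mult_ineq mult_left_mono order_trans)
      moreover have "norm (complex_of_real (s\<^sup>2) *\<^sub>C y) = s\<^sup>2 * norm y"
        unfolding norm_scaleC norm_of_real by simp
      ultimately have "norm (x * (x * y) + complex_of_real (s\<^sup>2) *\<^sub>C y)
          \<le> norm x * (norm x * norm y) + s\<^sup>2 * norm y"
        using norm_triangle_ineq[of "x * (x * y)" "complex_of_real (s\<^sup>2) *\<^sub>C y"] by linarith
      then show ?thesis by (simp add: mult_left_mono)
    qed
    also have "\<dots> = (sqrt ((norm x)\<^sup>2 + s\<^sup>2) * norm y)\<^sup>2"
      by (simp add: power_mult_distrib) (simp add: power2_eq_square algebra_simps)
    finally show ?thesis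
      by (rule power2_le_imp_le) simp
  qed
  moreover have "z \<noteq> 0" using Im by auto
  ultimately have "cmod (z + c) \<le> sqrt ((norm x)\<^sup>2 + s\<^sup>2)"
    using z by (intro uspec_shift_bound) auto
  then have "(cmod (z + c))\<^sup>2 \<le> (norm x)\<^sup>2 + s\<^sup>2"
    by (metis real_sqrt_le_iff real_sqrt_abs abs_norm_cancel)
  then have "(Re z)\<^sup>2 + (Im z)\<^sup>2 + 2 * s * Im z \<le> (norm x)\<^sup>2"
    by (simp add: cmod_power2 c_def power2_sum algebra_simps)
  moreover have "2 * s * Im z = (norm x)\<^sup>2 + 1"
    using Im by (simp add: s_def)
  ultimately show False
    using sum_power2_ge_zero[of "Re z" "Im z"] by linarith
qed

lemma average_of_inverses:
  fixes v :: "'r::real_algebra_1"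
  assumes S: "(1 - v) * S = 1" "S * (1 - v) = 1" and T: "(1 + v) * T = 1" "T * (1 + v) = 1"
  shows "(1 - v * v) * ((1/2) *\<^sub>R (S + T)) = 1" "((1/2) *\<^sub>R (S + T)) * (1 - v * v) = 1"
proof -
  have fac: "1 - v * v = (1 + v) * (1 - v)" "1 - v * v = (1 - v) * (1 + v)"
    by (simp_all add: algebra_simps)
  have "1 + v + (1 - v) = 1 + 1"
    by simp
  then have half: "(1/2) *\<^sub>R (1 + v + (1 - v)) = 1"
    by (simp only: scaleR_half_double)
  have "(1 - v * v) * S = 1 + v"
    unfolding fac(1) mult.assoc S by simp
  moreover have "(1 - v * v) * T = 1 - v"
    unfolding fac(2) mult.assoc T by simp
  moreover have "S * (1 - v * v) = 1 + v"
    unfolding fac(2) mult.assoc[symmetric] S by simp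
  moreover have "T * (1 - v * v) = 1 - v"
    unfolding fac(1) mult.assoc[symmetric] T by simp
  ultimately show "(1 - v * v) * ((1/2) *\<^sub>R (S + T)) = 1" "((1/2) *\<^sub>R (S + T)) * (1 - v * v) = 1"
    by (simp_all only: mult_scaleR_left mult_scaleR_right distrib_left distrib_right half)
qed

text \<open>If \<open>1 - z u\<close> were invertible for all \<open>z\<close> in the closed unit disc, the inverse would be a
  uniformly continuous function of \<open>z\<close>.  With a root \<open>\<zeta>\<close> of \<open>\<zeta>\<^sup>N = - 1\<close>, the average of
  the inverses of \<open>1 - z\<^sup>N u\<^sup>N\<close> and \<open>1 - (\<zeta> z)\<^sup>N u\<^sup>N\<close> is the inverse of
  \<open>1 - z\<^bsup>2N\<^esup> u\<^bsup>2N\<^esup>\<close>, so all these inverses for \<open>N\<close> a power of \<open>2\<close> share one modulus of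
  continuity.  For a fixed \<open>r < 1\<close> the inverse of \<open>1 - r\<^sup>N u\<^sup>N\<close> tends to \<open>1\<close>, hence the
  inverse of \<open>1 - u\<^sup>N\<close> is eventually near \<open>1\<close> as well, which forces \<open>u\<^sup>N\<close> to be small.\<close>

lemma exists_noninvertible_on_circle:
  fixes u :: "'a::cstar_algebra unitization"
  assumes pow: "\<And>k. norm (u ^ (2 ^ k)) = 1"
  shows "\<exists>z. cmod z = 1 \<and> \<not> invertible_elt (1 - usc z * u)"
proof (rule ccontr)
  assume contra: "\<not> ?thesis"
  have "norm u = 1" using pow[of 0] by simp
  have "invertible_elt (1 - usc z * u)" if "z \<in> cball 0 1" for z
  proof (cases "cmod z = 1")
    case False
    then show ?thesis
      using that \<open>norm u = 1\<close> by (intro invertible_elt_one_minus) simp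
  qed (use contra in blast)
  then obtain R where R: "\<And>z. z \<in> cball 0 1 \<Longrightarrow> (1 - usc z * u) * R z = 1"
    "\<And>z. z \<in> cball 0 1 \<Longrightarrow> R z * (1 - usc z * u) = 1"
    unfolding invertible_elt_def by metis
  have resolvent: "R z - R w = usc (z - w) * (R z * u * R w)"
    if "z \<in> cball 0 1" "w \<in> cball 0 1" for z w
  proof -
    have "R z - R w = R z * ((1 - usc w * u) * R w) - (R z * (1 - usc z * u)) * R w"
      using that by (simp only: R mult_1_left mult_1_right)
    also have "\<dots> = R z * (usc (z - w) * (u * R w))"
      by (simp add: usc_simps algebra_simps)
    also have "\<dots> = (R z * usc (z - w)) * (u * R w)"
      by (simp only: mult.assoc)
    also have "\<dots> = usc (z - w) * (R z * u * R w)"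
      by (simp only: usc_commute[of "z - w", symmetric] mult.assoc)
    finally show ?thesis .
  qed
  have "continuous_on (cball 0 1) R"
    unfolding continuous_on_def
  proof
    fix w :: complex assume w: "w \<in> cball 0 1"
    define C where "C = norm (R w)"
    have "norm (R z - R w) \<le> cmod (z - w) * (2 * C * C)"
      if z: "z \<in> cball 0 1" "cmod (z - w) * C \<le> 1/2" for z
    proof -
      have le: "norm (R z - R w) \<le> cmod (z - w) * (norm (R z) * C)"
      proof -
        have "norm (R z * u * R w) \<le> norm (R z) * norm u * norm (R w)"
          by (meson norm_ge_zero norm_mult_ineq mult_right_mono order_trans)
        then show ?thesis
          using \<open>norm u = 1\<close> unfolding resolvent[OF z(1) w] norm_usc_mult C_def
          by (intro mult_left_mono) auto
      qed
      have "cmod (z - w) * (norm (R z) * C) \<le> norm (R z) * (1/2)"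
        using mult_left_mono[OF z(2), of "norm (R z)"] by (simp add: ac_simps)
      then have "norm (R z) \<le> 2 * C"
        using le norm_triangle_ineq2[of "R z" "R w"] unfolding C_def by linarith
      then have "cmod (z - w) * (norm (R z) * C) \<le> cmod (z - w) * (2 * C * C)"
        by (intro mult_left_mono mult_right_mono) (auto simp: C_def)
      with le show ?thesis by linarith
    qed
    moreover have "\<forall>\<^sub>F z in at w within cball 0 1. cmod (z - w) * C < 1/2"
    proof -
      have "((\<lambda>z. cmod (z - w) * C) \<longlongrightarrow> cmod (w - w) * C) (at w within cball 0 1)"
        by (intro tendsto_intros)
      then show ?thesis by (rule order_tendstoD) simp
    qed
    ultimately have "\<forall>\<^sub>F z in at w within cball 0 1.
        norm (R z - R w) \<le> cmod (z - w) * (2 * C * C)"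
      unfolding eventually_at_topological by (metis less_imp_le)
    moreover have "((\<lambda>z. cmod (z - w) * (2 * C * C)) \<longlongrightarrow> cmod (w - w) * (2 * C * C))
        (at w within cball 0 1)"
      by (intro tendsto_intros)
    ultimately have "((\<lambda>z. R z - R w) \<longlongrightarrow> 0) (at w within cball 0 1)"
      by (intro Lim_null_comparison[of "\<lambda>z. R z - R w"]) simp_all
    then show "(R \<longlongrightarrow> R w) (at w within cball 0 1)"
      by (simp add: LIM_zero_iff)
  qed
  then have "uniformly_continuous_on (cball 0 1) R"
    by (rule compact_uniformly_continuous) simp
  then obtain d where d: "0 < d" "\<And>z w. z \<in> cball 0 1 \<Longrightarrow> w \<in> cball 0 1 \<Longrightarrow> dist z w < d \<Longrightarrow>
      dist (R z) (R w) < 1/8"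
    unfolding uniformly_continuous_on_def by (metis zero_less_divide_1_iff zero_less_numeral)
  have powers: "\<exists>S. (\<forall>z\<in>cball 0 1. (1 - usc (z ^ (2 ^ k)) * u ^ (2 ^ k)) * S z = 1 \<and>
        S z * (1 - usc (z ^ (2 ^ k)) * u ^ (2 ^ k)) = 1) \<and>
      (\<forall>z\<in>cball 0 1. \<forall>w\<in>cball 0 1. dist z w < d \<longrightarrow> norm (S z - S w) \<le> 1/8)" for k
  proof (induction k)
    case 0
    show ?case
      using R d(2) by (intro exI[of _ R]) (auto simp: dist_norm less_imp_le)
  next
    case (Suc k)
    let ?N = "2 ^ k :: nat"
    let ?w = "\<lambda>z. usc (z ^ ?N) * u ^ ?N"
    obtain S where S: "\<And>z. z \<in> cball 0 1 \<Longrightarrow> (1 - ?w z) * S z = 1"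
      "\<And>z. z \<in> cball 0 1 \<Longrightarrow> S z * (1 - ?w z) = 1"
      "\<And>z w. z \<in> cball 0 1 \<Longrightarrow> w \<in> cball 0 1 \<Longrightarrow> dist z w < d \<Longrightarrow> norm (S z - S w) \<le> 1/8"
      using Suc by blast
    define \<zeta> where "\<zeta> = cis (pi / real ?N)"
    have "\<zeta> ^ ?N = cis (real ?N * (pi / real ?N))"
      unfolding \<zeta>_def by (rule Complex.DeMoivre)
    then have zeta: "\<zeta> ^ ?N = - 1" "cmod \<zeta> = 1"
      by (simp_all add: \<zeta>_def)
    have mem: "\<zeta> * z \<in> cball 0 1" if "z \<in> cball 0 1" for z
      using that zeta by (simp add: norm_mult)
    have w_zeta: "?w (\<zeta> * z) = - ?w z" for z
      by (simp add: power_mult_distrib zeta usc_simps)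
    have w_square: "usc (z ^ 2 ^ Suc k) * u ^ 2 ^ Suc k = ?w z * ?w z" for z
    proof -
      have "usc (z ^ 2 ^ Suc k) * u ^ 2 ^ Suc k = usc (z ^ ?N) * (usc (z ^ ?N) * u ^ ?N) * u ^ ?N"
        unfolding power_Suc mult_2 power_add usc_simps by (simp only: mult.assoc)
      also have "\<dots> = usc (z ^ ?N) * (u ^ ?N * usc (z ^ ?N)) * u ^ ?N"
        by (simp only: usc_commute[of "z ^ ?N" "u ^ ?N"])
      also have "\<dots> = ?w z * ?w z"
        by (simp only: mult.assoc)
      finally show ?thesis .
    qed
    define T where "T z = (1/2) *\<^sub>R (S z + S (\<zeta> * z))" for z
    have inv: "(1 - ?w z * ?w z) * T z = 1 \<and> T z * (1 - ?w z * ?w z) = 1"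
      if z: "z \<in> cball 0 1" for z
      unfolding T_def using S(1,2)[OF z] S(1,2)[OF mem[OF z]] unfolding w_zeta
      by (intro conjI average_of_inverses) simp_all
    moreover have "norm (T z - T w) \<le> 1/8"
      if z: "z \<in> cball 0 1" "w \<in> cball 0 1" "dist z w < d" for z w
    proof -
      have "dist (\<zeta> * z) (\<zeta> * w) < d"
        using z(3) zeta(2) by (simp add: dist_norm norm_mult flip: right_diff_distrib)
      then have *: "norm (S z - S w) \<le> 1/8" "norm (S (\<zeta> * z) - S (\<zeta> * w)) \<le> 1/8"
        using S(3) z mem by blast+
      have "T z - T w = (1/2) *\<^sub>R ((S z - S w) + (S (\<zeta> * z) - S (\<zeta> * w)))"
        unfolding T_def by (simp add: algebra_simps)
      then show ?thesis
        using * norm_triangle_ineq[of "S z - S w" "S (\<zeta> * z) - S (\<zeta> * w)"] by simp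
    qed
    ultimately show ?case
      unfolding w_square by (intro exI[of _ T]) blast
  qed
  define r where "r = max (1/2) (1 - d/2)"
  have r: "0 < r" "r < 1" "1 - r < d" using d(1) by (auto simp: r_def)
  obtain k where k: "r ^ k < 1/8"
    using real_arch_pow_inv[of "1/8" r] r by auto
  have "r ^ 2 ^ k \<le> r ^ k"
    using r less_exp[of k] by (intro power_decreasing) auto
  with k have rk: "r ^ 2 ^ k < 1/8" by linarith
  obtain S where S: "\<And>z. z \<in> cball 0 1 \<Longrightarrow> (1 - usc (z ^ 2 ^ k) * u ^ 2 ^ k) * S z = 1"
      "\<And>z w. z \<in> cball 0 1 \<Longrightarrow> w \<in> cball 0 1 \<Longrightarrow> dist z w < d \<Longrightarrow> norm (S z - S w) \<le> 1/8"
    using powers[of k] by blast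
  define X where "X = u ^ 2 ^ k"
  have X: "norm X = 1" using pow by (simp add: X_def)
  let ?r = "complex_of_real r"
  have mem: "?r \<in> cball 0 1" "1 \<in> cball (0::complex) 1" using r by auto
  define E where "E = S 1 - 1"
  define F where "F = S ?r - 1"
  have "dist 1 ?r < d"
    using dist_of_real[of 1 r, where ?'a = complex] r by (simp add: dist_real_def)
  then have "norm (S 1 - S ?r) \<le> 1/8"
    by (rule S(2)[OF mem(2,1)])
  moreover have "norm F \<le> 1/7"
  proof -
    have "F = usc (?r ^ 2 ^ k) * (X * S ?r)"
      using S(1)[OF mem(1)] by (simp add: F_def X_def algebra_simps)
    then have "norm F \<le> r ^ 2 ^ k * (norm X * norm (S ?r))"
      using r norm_mult_ineq[of X "S ?r"] by (simp add: norm_power mult_left_mono)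
    also have "\<dots> \<le> 1/8 * norm (S ?r)"
      using mult_right_mono[of "r ^ 2 ^ k" "1/8" "norm (S ?r)"] rk X by simp
    also have "norm (S ?r) \<le> 1 + norm F"
      using norm_triangle_ineq[of 1 F] by (simp add: F_def)
    finally show ?thesis by simp
  qed
  ultimately have E: "norm E \<le> 1/8 + 1/7"
    using norm_triangle_ineq[of "S 1 - S ?r" F] by (simp add: E_def F_def)
  have "(1 - X) * S 1 = 1"
    using S(1)[OF mem(2)] by (simp only: power_one usc_simps mult_1_left X_def)
  then have "X = E - X * E"
    unfolding E_def left_diff_distrib right_diff_distrib by (simp add: algebra_simps)
  then have "norm X = norm (E - X * E)"
    by (rule arg_cong)
  also have "\<dots> \<le> norm E + norm X * norm E"
    using norm_triangle_ineq4[of E "X * E"] norm_mult_ineq[of X E] by linarith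
  finally show False using X E by simp
qed

text \<open>By the C*-identity the powers of a self-adjoint element of norm \<open>1\<close> with exponents \<open>2\<^sup>k\<close> have
  norm \<open>1\<close>.  This reduces the claim to the noninvertibility on the unit circle.\<close>

lemma uspec_selfadjoint_attains_norm:
  fixes x :: "'a::cstar_algebra"
  assumes x: "star x = x"
  shows "\<exists>z\<in>uspec x. cmod z = norm x"
proof (cases "x = 0")
  case True
  then show ?thesis by (intro bexI[of _ 0]) simp_all
next
  case False
  define c where "c = complex_of_real (inverse (norm x))"
  have c: "c \<noteq> 0" "cmod c * norm x = 1" using False by (simp_all add: c_def norm_inverse)
  have "\<exists>y. emb (c *\<^sub>C x) ^ 2 ^ k = emb y \<and> star y = y \<and> norm y = 1" for k
  proof (induction k)
    case 0
    show ?case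
      using x c by (intro exI[of _ "c *\<^sub>C x"]) (simp add: star_scaleC norm_scaleC c_def)
  next
    case (Suc k)
    then obtain y where y: "emb (c *\<^sub>C x) ^ 2 ^ k = emb y" "star y = y" "norm y = 1" by blast
    have "emb (c *\<^sub>C x) ^ 2 ^ Suc k = emb (y * y)"
      unfolding power_Suc mult_2 power_add y(1) by (rule emb_simps(5)[symmetric])
    moreover have "star (y * y) = y * y" "norm (y * y) = 1"
      using y by (simp_all add: star_mult norm_square_selfadjoint)
    ultimately show ?case by blast
  qed
  then have "norm (emb (c *\<^sub>C x) ^ 2 ^ k) = 1" for k
    by (metis norm_emb)
  then obtain z where z: "cmod z = 1" "\<not> invertible_elt (1 - usc z * emb (c *\<^sub>C x))"
    using exists_noninvertible_on_circle by blast
  have zc: "z * c \<noteq> 0" using z(1) c by auto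
  have "1 - usc z * emb (c *\<^sub>C x) = usc (- (z * c)) * (emb x - usc (inverse (z * c)))"
    using zc by (intro unitization.expand) (simp add: scaleC_scaleC algebra_simps)
  with z(2) zc have "inverse (z * c) \<in> uspec x"
    unfolding uspec_def
    by (metis (no_types, lifting) invertible_elt_mult invertible_usc mem_Collect_eq
        neg_equal_0_iff_equal)
  moreover have "cmod (inverse (z * c)) = norm x"
    using z(1) False by (simp add: norm_inverse norm_mult c_def)
  ultimately show ?thesis by blast
qed

text \<open>The analytic core.  The self-adjoint element \<open>p(x)\<^sup>* p(x)\<close> is a polynomial in \<open>x\<close> whose
  values on the real set \<open>uspec x\<close> are \<open>\<bar>p\<bar>\<^sup>2\<close>.\<close>

lemma norm_aev_le:
  fixes x :: "'a::cstar_algebra"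
  assumes x: "star x = x" and p: "poly p 0 = 0" and M: "\<And>z. z \<in> uspec x \<Longrightarrow> cmod (poly p z) \<le> M"
  shows "norm (aev p x) \<le> M"
proof -
  let ?q = "map_poly cnj p * p"
  have q: "aev ?q x = star (aev p x) * aev p x"
    using p x by (simp add: aev_mult star_aev)
  then have "star (aev ?q x) = aev ?q x"
    by (simp add: star_mult star_star)
  then obtain w where "w \<in> uspec (aev ?q x)" and w: "cmod w = norm (aev ?q x)"
    using uspec_selfadjoint_attains_norm by blast
  then obtain z where z: "z \<in> uspec x" "w = poly ?q z"
    using p by (auto elim: uspec_aevE)
  have "cnj z = z"
    using uspec_selfadjoint_real[OF x z(1)] by (simp add: complex_eq_iff)
  then have "cmod w = (cmod (poly p z))\<^sup>2"
    using z(2) by (simp add: norm_mult power2_eq_square)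
  with w q have "(norm (aev p x))\<^sup>2 = (cmod (poly p z))\<^sup>2"
    by (simp add: cstar_identity)
  then have "norm (aev p x) = cmod (poly p z)"
    by (simp add: power2_eq_iff_nonneg)
  with M[OF z(1)] show ?thesis by simp
qed

section \<open>Continuous functions of a self-adjoint element\<close>

text \<open>\<open>is_cfc x g y\<close> says that \<open>y = g(x)\<close> in the continuous functional calculus of a
  self-adjoint \<open>x\<close>.  As polynomials without constant term are used, \<open>y\<close> lies in the algebra and
  \<open>g\<close> vanishes at \<open>0\<close>.  The spectrum of \<open>x\<close> is real, hence \<open>g\<close> is evaluated at real parts.\<close>

definition is_cfc :: "'a::cstar_algebra \<Rightarrow> (real \<Rightarrow> real) \<Rightarrow> 'a \<Rightarrow> bool" where
  "is_cfc x g y \<longleftrightarrow> (\<exists>P. (\<forall>n. poly (P n) 0 = 0) \<and>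
     uniform_limit (uspec x) (\<lambda>n. poly (P n)) (\<lambda>z. complex_of_real (g (Re z))) sequentially \<and>
     (\<lambda>n. aev (P n) x) \<longlonglongrightarrow> y)"

lemma is_cfc_poly:
  assumes "poly p 0 = 0" "\<And>z. z \<in> uspec x \<Longrightarrow> poly p z = complex_of_real (g (Re z))"
  shows "is_cfc x g (aev p x)"
proof -
  have "uniform_limit (uspec x) (\<lambda>n::nat. poly p) (\<lambda>z. complex_of_real (g (Re z))) sequentially"
    by (rule uniform_limitI) (simp add: assms(2))
  with assms(1) show ?thesis
    unfolding is_cfc_def by (intro exI[of _ "\<lambda>n. p"]) simp
qed

lemma is_cfc_self:
  assumes "star x = x"
  shows "is_cfc x (\<lambda>t. t) x"
  using is_cfc_poly[of "[:0, 1:]" x "\<lambda>t. t"] uspec_selfadjoint_real[OF assms]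
  by (simp add: aev_X complex_eq_iff)

lemma is_cfc_diff:
  assumes "is_cfc x g y" "is_cfc x h w"
  shows "is_cfc x (\<lambda>t. g t - h t) (y - w)"
proof -
  obtain P Q where
    P: "\<And>n. poly (P n) 0 = 0"
      "uniform_limit (uspec x) (\<lambda>n. poly (P n)) (\<lambda>z. complex_of_real (g (Re z))) sequentially"
      "(\<lambda>n. aev (P n) x) \<longlonglongrightarrow> y" and
    Q: "\<And>n. poly (Q n) 0 = 0"
      "uniform_limit (uspec x) (\<lambda>n. poly (Q n)) (\<lambda>z. complex_of_real (h (Re z))) sequentially"
      "(\<lambda>n. aev (Q n) x) \<longlonglongrightarrow> w"
    using assms unfolding is_cfc_def by blast
  have "poly (P n - Q n) = (\<lambda>z. poly (P n) z - poly (Q n) z)" for n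
    by (simp add: fun_eq_iff)
  then show ?thesis
    unfolding is_cfc_def
    using uniform_limit_minus[OF P(2) Q(2)] tendsto_diff[OF P(3) Q(3)] P(1) Q(1)
    by (intro exI[of _ "\<lambda>n. P n - Q n"]) (simp add: aev_diff)
qed

lemma bounded_uspec: "bounded (uspec (x :: 'a::cstar_algebra))"
  using norm_uspec_le unfolding bounded_iff by blast

lemma bounded_poly_uspec: "bounded (poly p ` uspec (x :: 'a::cstar_algebra))"
proof -
  have "compact (poly p ` closure (uspec x))"
    by (intro compact_continuous_image continuous_intros)
      (simp add: compact_eq_bounded_closed bounded_closure bounded_uspec)
  then show ?thesis
    by (meson bounded_subset closure_subset compact_imp_bounded image_mono)
qed

lemma bounded_cfc_function:
  assumes "uniform_limit (uspec x) (\<lambda>n. poly (P n)) f sequentially"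
  shows "bounded (f ` uspec (x :: 'a::cstar_algebra))"
proof -
  obtain n where n: "\<And>z. z \<in> uspec x \<Longrightarrow> dist (poly (P n) z) (f z) < 1"
    using uniform_limitD[OF assms, of 1] by (auto simp: eventually_sequentially)
  obtain B where B: "\<And>z. z \<in> uspec x \<Longrightarrow> norm (poly (P n) z) \<le> B"
    using bounded_poly_uspec[of "P n" x] by (auto simp: bounded_iff)
  have "norm (f z) \<le> B + 1" if "z \<in> uspec x" for z
    using n[OF that] B[OF that] norm_triangle_ineq2[of "f z" "poly (P n) z"]
    by (simp add: dist_norm norm_minus_commute)
  then show ?thesis unfolding bounded_iff by blast
qed

lemma is_cfc_mult:
  assumes "is_cfc x g y" "is_cfc x h w"
  shows "is_cfc x (\<lambda>t. g t * h t) (y * w)"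
proof -
  obtain P Q where
    P: "\<And>n. poly (P n) 0 = 0"
      "uniform_limit (uspec x) (\<lambda>n. poly (P n)) (\<lambda>z. complex_of_real (g (Re z))) sequentially"
      "(\<lambda>n. aev (P n) x) \<longlonglongrightarrow> y" and
    Q: "\<And>n. poly (Q n) 0 = 0"
      "uniform_limit (uspec x) (\<lambda>n. poly (Q n)) (\<lambda>z. complex_of_real (h (Re z))) sequentially"
      "(\<lambda>n. aev (Q n) x) \<longlonglongrightarrow> w"
    using assms unfolding is_cfc_def by blast
  have "uniform_limit (uspec x) (\<lambda>n z. poly (P n) z * poly (Q n) z)
      (\<lambda>z. complex_of_real (g (Re z)) * complex_of_real (h (Re z))) sequentially"
    by (intro uniform_lim_mult P Q bounded_cfc_function[where P = P] bounded_cfc_function[where P = Q])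
  moreover have "poly (P n * Q n) = (\<lambda>z. poly (P n) z * poly (Q n) z)" for n
    by (simp add: fun_eq_iff)
  ultimately show ?thesis
    unfolding is_cfc_def
    using tendsto_mult[OF P(3) Q(3)] P(1) Q(1)
    by (intro exI[of _ "\<lambda>n. P n * Q n"]) (simp add: aev_mult)
qed

lemma norm_is_cfc_le:
  assumes x: "star x = x" and "is_cfc x g y" and M: "\<And>z. z \<in> uspec x \<Longrightarrow> \<bar>g (Re z)\<bar> \<le> M"
  shows "norm y \<le> M"
proof -
  obtain P where P: "\<And>n. poly (P n) 0 = 0"
      "uniform_limit (uspec x) (\<lambda>n. poly (P n)) (\<lambda>z. complex_of_real (g (Re z))) sequentially"
      "(\<lambda>n. aev (P n) x) \<longlonglongrightarrow> y"
    using assms unfolding is_cfc_def by blast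
  have "norm y \<le> M + e" if "0 < e" for e
  proof (rule tendsto_upperbound)
    show "(\<lambda>n. norm (aev (P n) x)) \<longlonglongrightarrow> norm y" using P(3) by (rule tendsto_norm)
    show "\<forall>\<^sub>F n in sequentially. norm (aev (P n) x) \<le> M + e"
      using uniform_limitD[OF P(2) that]
    proof eventually_elim
      case (elim n)
      show ?case
      proof (rule norm_aev_le[OF x P(1)])
        fix z assume z: "z \<in> uspec x"
        with elim have "cmod (poly (P n) z - complex_of_real (g (Re z))) < e"
          by (simp add: dist_norm)
        moreover have "cmod (complex_of_real (g (Re z))) \<le> M"
          using M[OF z] by simp
        ultimately show "cmod (poly (P n) z) \<le> M + e"
          using norm_triangle_ineq2[of "poly (P n) z" "complex_of_real (g (Re z))"] by linarith
      qed
    qed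
  qed simp
  then show ?thesis by (rule field_le_epsilon)
qed

lemma abs_cfc_function_le_norm:
  assumes "is_cfc x g y" "z \<in> uspec x"
  shows "\<bar>g (Re z)\<bar> \<le> norm y"
proof -
  obtain P where P: "\<And>n. poly (P n) 0 = 0"
      "uniform_limit (uspec x) (\<lambda>n. poly (P n)) (\<lambda>z. complex_of_real (g (Re z))) sequentially"
      "(\<lambda>n. aev (P n) x) \<longlonglongrightarrow> y"
    using assms unfolding is_cfc_def by blast
  have "cmod (poly (P n) z) \<le> norm (aev (P n) x)" for n
    using P(1) assms(2) by (intro norm_uspec_le poly_in_uspec_aev)
  moreover have "(\<lambda>n. cmod (poly (P n) z)) \<longlonglongrightarrow> cmod (complex_of_real (g (Re z)))"
    using tendsto_uniform_limitI[OF P(2) assms(2)] by (rule tendsto_norm)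
  ultimately have "cmod (complex_of_real (g (Re z))) \<le> norm y"
    using P(3) by (intro LIMSEQ_le[OF _ tendsto_norm]) auto
  then show ?thesis by simp
qed

lemma is_cfc_unique:
  assumes x: "star x = x" and y: "is_cfc x g y" and w: "is_cfc x h w"
    and eq: "\<And>z. z \<in> uspec x \<Longrightarrow> g (Re z) = h (Re z)"
  shows "y = w"
  using norm_is_cfc_le[OF x is_cfc_diff[OF y w], of 0] eq by simp

lemma is_cfc_selfadjoint:
  assumes x: "star x = x" and y: "is_cfc x g y"
  shows "star y = y"
proof -
  obtain P where P: "\<And>n. poly (P n) 0 = 0"
      "uniform_limit (uspec x) (\<lambda>n. poly (P n)) (\<lambda>z. complex_of_real (g (Re z))) sequentially"
      "(\<lambda>n. aev (P n) x) \<longlonglongrightarrow> y"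
    using y unfolding is_cfc_def by blast
  have "uniform_limit (uspec x) (\<lambda>n. poly (map_poly cnj (P n)))
      (\<lambda>z. complex_of_real (g (Re z))) sequentially"
  proof (rule uniform_limitI)
    fix e :: real assume "0 < e"
    from uniform_limitD[OF P(2) this]
    show "\<forall>\<^sub>F n in sequentially. \<forall>z\<in>uspec x.
        dist (poly (map_poly cnj (P n)) z) (complex_of_real (g (Re z))) < e"
    proof eventually_elim
      case (elim n)
      show ?case
      proof
        fix z assume z: "z \<in> uspec x"
        have "cnj z = z"
          using uspec_selfadjoint_real[OF x z] by (simp add: complex_eq_iff)
        then have "poly (map_poly cnj (P n)) z - complex_of_real (g (Re z)) =
            cnj (poly (P n) z - complex_of_real (g (Re z)))"
          by simp
        then show "dist (poly (map_poly cnj (P n)) z) (complex_of_real (g (Re z))) < e"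
          using bspec[OF elim z] by (simp only: dist_norm complex_mod_cnj)
      qed
    qed
  qed
  then have "is_cfc x g (star y)"
    unfolding is_cfc_def
    using P(1) tendsto_star[OF P(3)] x
    by (intro exI[of _ "\<lambda>n. map_poly cnj (P n)"]) (simp add: star_aev)
  then show ?thesis
    using is_cfc_unique[OF x _ y] by blast
qed

text \<open>Substituting \<open>t\<^sup>2\<close> into the approximating polynomials turns polynomials in \<open>x\<^sup>2\<close> into
  polynomials in \<open>x\<close>.\<close>

lemma is_cfc_square:
  assumes x: "star x = x" and y: "is_cfc (x * x) g y"
  shows "is_cfc x (\<lambda>t. g (t * t)) y"
proof -
  obtain P where P: "\<And>n. poly (P n) 0 = 0"
      "uniform_limit (uspec (x * x)) (\<lambda>n. poly (P n)) (\<lambda>z. complex_of_real (g (Re z))) sequentially"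
      "(\<lambda>n. aev (P n) (x * x)) \<longlonglongrightarrow> y"
    using y unfolding is_cfc_def by blast
  let ?s = "[:0, 0, 1:] :: complex poly"
  have s: "aev ?s x = x * x" "poly ?s z = z * z" for z
    by (simp_all add: aev_pCons aev_X[simplified] aev_def usc_simps scaleC_one)
  have mem: "z * z \<in> uspec (x * x)" if "z \<in> uspec x" for z
    using poly_in_uspec_aev[of ?s z x] that s by simp
  have Re: "Re (z * z) = Re z * Re z" if "z \<in> uspec x" for z
    using uspec_selfadjoint_real[OF x that] by simp
  have comp: "upoly (pcompose p ?s) (emb x) = upoly p (emb (x * x))" for p
    by (induction p) (simp_all add: pcompose_pCons upoly_add upoly_mult usc_simps emb_simps mult.assoc)
  have "uniform_limit (uspec x) (\<lambda>n z. poly (P n) (z * z))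
      (\<lambda>z. complex_of_real (g (Re (z * z)))) sequentially"
    by (rule uniform_limit_compose'[OF P(2)]) (use mem in auto)
  then have "uniform_limit (uspec x) (\<lambda>n. poly (pcompose (P n) ?s))
      (\<lambda>z. complex_of_real (g (Re z * Re z))) sequentially"
    unfolding uniform_limit_iff using Re by (simp add: poly_pcompose)
  moreover have "aev (pcompose (P n) ?s) x = aev (P n) (x * x)" for n
    by (simp add: aev_def comp)
  ultimately show ?thesis
    unfolding is_cfc_def using P by (intro exI[of _ "\<lambda>n. pcompose (P n) ?s"]) (simp add: poly_pcompose)
qed

text \<open>Weierstrass approximation on an interval containing the spectrum; as
  \<open>g 0 = 0\<close>, the constant term of the approximating polynomial is small and can be removed.\<close>

lemma ex_is_cfc:
  fixes x :: "'a::cstar_algebra"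
  assumes x: "star x = x" and g: "continuous_on UNIV g" "g 0 = 0"
  shows "\<exists>y. is_cfc x g y"
proof -
  have "\<exists>p. poly p 0 = 0 \<and> (\<forall>z\<in>uspec x. cmod (poly p z - complex_of_real (g (Re z))) < e)"
    if e: "0 < e" for e
  proof -
    have "continuous_on {- norm x..norm x} g"
      using g(1) by (rule continuous_on_subset) simp
    then obtain q where "real_polynomial_function q"
      and close: "\<And>t. t \<in> {- norm x..norm x} \<Longrightarrow> \<bar>g t - q t\<bar> < e / 2"
      using Stone_Weierstrass_real_polynomial_function[of "{- norm x..norm x}" g "e / 2"] e
      by auto
    then obtain a n where q: "q = (\<lambda>t. \<Sum>i\<le>n. a i * t ^ i)"
      unfolding real_polynomial_function_iff_sum by blast
    define p where "p = (\<Sum>i\<le>n. monom (complex_of_real (a i)) i) - [:complex_of_real (q 0):]"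
    have p: "poly p (complex_of_real t) = complex_of_real (q t - q 0)" for t
      by (simp add: p_def poly_sum poly_monom q)
    have "cmod (poly p z - complex_of_real (g (Re z))) < e" if z: "z \<in> uspec x" for z
    proof -
      have zr: "z = complex_of_real (Re z)"
        using uspec_selfadjoint_real[OF x z] by (simp add: complex_eq_iff)
      have "\<bar>Re z\<bar> \<le> norm x"
        using abs_Re_le_cmod[of z] norm_uspec_le[OF z] by linarith
      then have "\<bar>g (Re z) - q (Re z)\<bar> < e / 2" by (intro close) auto
      moreover have "\<bar>g 0 - q 0\<bar> < e / 2" by (intro close) auto
      ultimately have "\<bar>q (Re z) - q 0 - g (Re z)\<bar> < e" using g(2) by linarith
      moreover have "poly p z - complex_of_real (g (Re z)) =
          complex_of_real (q (Re z) - q 0 - g (Re z))"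
        using p[of "Re z"] zr by simp
      ultimately show ?thesis by (simp only: norm_of_real)
    qed
    moreover have "poly p 0 = 0" using p[of 0] by simp
    ultimately show ?thesis by blast
  qed
  then have "\<forall>n. \<exists>p. poly p 0 = 0 \<and>
      (\<forall>z\<in>uspec x. cmod (poly p z - complex_of_real (g (Re z))) < 1 / real (Suc n))"
    by simp
  then obtain P where P: "\<And>n. poly (P n) 0 = 0"
    "\<And>n z. z \<in> uspec x \<Longrightarrow> cmod (poly (P n) z - complex_of_real (g (Re z))) < 1 / real (Suc n)"
    by metis
  have small: "cmod (poly (P n) z - complex_of_real (g (Re z))) < e"
    if "z \<in> uspec x" "1 / real (Suc N) < e" "N \<le> n" for z e n N
  proof -
    have "1 / real (Suc n) \<le> 1 / real (Suc N)"
      using that by (intro divide_left_mono) auto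
    with P(2)[OF that(1), of n] that(2) show ?thesis by linarith
  qed
  have "uniform_limit (uspec x) (\<lambda>n. poly (P n)) (\<lambda>z. complex_of_real (g (Re z))) sequentially"
  proof (rule uniform_limitI)
    fix e :: real assume "0 < e"
    then obtain N where "1 / real (Suc N) < e" by (rule nat_approx_posE)
    then show "\<forall>\<^sub>F n in sequentially. \<forall>z\<in>uspec x.
        dist (poly (P n) z) (complex_of_real (g (Re z))) < e"
      unfolding eventually_sequentially dist_norm using small by blast
  qed
  moreover have "Cauchy (\<lambda>n. aev (P n) x)"
  proof (rule metric_CauchyI)
    fix e :: real assume "0 < e"
    then obtain N where N: "1 / real (Suc N) < e / 3"
      using nat_approx_posE[of "e / 3"] by auto
    have "dist (aev (P m) x) (aev (P n) x) < e" if "N \<le> m" "N \<le> n" for m n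
    proof -
      have "cmod (poly (P m - P n) z) \<le> 2 * (e / 3)" if z: "z \<in> uspec x" for z
        using small[OF z N \<open>N \<le> m\<close>] small[OF z N \<open>N \<le> n\<close>]
          norm_triangle_ineq4[of "poly (P m) z - complex_of_real (g (Re z))"
            "poly (P n) z - complex_of_real (g (Re z))"]
        by simp
      then have "norm (aev (P m - P n) x) \<le> 2 * (e / 3)"
        using P(1) by (intro norm_aev_le[OF x]) auto
      with \<open>0 < e\<close> show ?thesis by (simp add: dist_norm aev_diff)
    qed
    then show "\<exists>N. \<forall>m\<ge>N. \<forall>n\<ge>N. dist (aev (P m) x) (aev (P n) x) < e" by blast
  qed
  ultimately show ?thesis
    unfolding is_cfc_def using P(1) by (auto simp: Cauchy_convergent_iff convergent_def)
qed

section \<open>Positive elements\<close>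

lemma aev_square: "aev [:0, 0, 1:] x = x * x"
  by (simp add: aev_def usc_simps scaleC_one)

lemma positive_iff_uspec: "positive x \<longleftrightarrow> star x = x \<and> (\<forall>z\<in>uspec x. 0 \<le> Re z)"
proof (intro iffI conjI ballI)
  assume x: "positive x"
  then show "star x = x" by (simp add: positive_def)
  fix z assume "z \<in> uspec x"
  with x show "0 \<le> Re z" by (auto simp: positive_def uspec_eq)
next
  assume x: "star x = x \<and> (\<forall>z\<in>uspec x. 0 \<le> Re z)"
  have "z \<in> complex_of_real ` {0..}" if "z \<in> spectrum x" for z
  proof
    have z: "z \<in> uspec x" using that by (simp add: uspec_eq)
    then show "Re z \<in> {0..}" using x by simp
    show "z = complex_of_real (Re z)"
      using uspec_selfadjoint_real[OF _ z] x by (simp add: complex_eq_iff)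
  qed
  with x show "positive x" by (auto simp: positive_def)
qed

lemma positive_square:
  assumes w: "star w = w"
  shows "positive (w * w)"
  unfolding positive_iff_uspec
proof (intro conjI ballI)
  show "star (w * w) = w * w" by (simp add: star_mult w)
  fix z assume "z \<in> uspec (w * w)"
  then have "z \<in> uspec (aev [:0, 0, 1:] w)" by (simp only: aev_square)
  then obtain l where l: "l \<in> uspec w" "z = poly [:0, 0, 1:] l"
    by (rule uspec_aevE) simp
  then show "0 \<le> Re z"
    using uspec_selfadjoint_real[OF w l(1)] by simp
qed

text \<open>For \<open>T = x - R\<close> the numbers \<open>a\<^sub>n = \<parallel>T\<^sup>n y\<parallel>\<close> are logarithmically convex because
  \<open>\<parallel>T u\<parallel>\<^sup>2 = \<parallel>u\<^sup>* T\<^sup>2 u\<parallel>\<close>, so that they grow at least like \<open>(a\<^sub>1 / a\<^sub>0)\<^sup>n\<close>; on the other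
  hand \<open>T\<^sup>n\<close> differs from a polynomial in \<open>x\<close> without constant term by a scalar, which bounds them by
  a multiple of \<open>R\<^sup>n\<close>.\<close>

lemma positive_shift_bound:
  fixes x :: "'a::cstar_algebra"
  assumes x: "star x = x" and R: "0 \<le> R" "\<And>z. z \<in> uspec x \<Longrightarrow> cmod (z - complex_of_real R) \<le> R"
  shows "norm (x * y - complex_of_real R *\<^sub>C y) \<le> R * norm y"
proof -
  let ?R = "complex_of_real R"
  define T where "T u = x * u - ?R *\<^sub>C u" for u
  define a where "a n = norm ((T ^^ n) y)" for n
  have emb_T: "emb (T u) = upoly [:- ?R, 1:] (emb x) * emb u" for u
    by (simp add: T_def emb_simps usc_simps algebra_simps)
  have emb_Tn: "emb ((T ^^ n) y) = upoly ([:- ?R, 1:] ^ n) (emb x) * emb y" for n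
    by (induction n) (simp_all only: funpow.simps o_apply id_apply emb_T power_0 upoly_1
        mult_1_left power_Suc upoly_mult mult.assoc)
  have upper: "a n \<le> 3 * norm y * R ^ n" for n
  proof -
    let ?p = "[:- ?R, 1:] ^ n - [:(- ?R) ^ n:]"
    have p0: "poly ?p 0 = 0" by simp
    have "norm (aev ?p x) \<le> 2 * R ^ n"
    proof (rule norm_aev_le[OF x p0])
      fix z assume "z \<in> uspec x"
      then have "cmod ((z - ?R) ^ n) \<le> R ^ n"
        using R by (simp add: norm_power power_mono)
      moreover have "cmod ((- ?R) ^ n) = R ^ n"
        using R(1) by (simp add: norm_power)
      moreover have "poly ?p z = (z - ?R) ^ n - (- ?R) ^ n" by simp
      ultimately show "cmod (poly ?p z) \<le> 2 * R ^ n"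
        using norm_triangle_ineq4[of "(z - ?R) ^ n" "(- ?R) ^ n"] by (simp only:)
    qed
    then have "norm (aev ?p x * y) \<le> 2 * R ^ n * norm y"
      by (rule order_trans[OF norm_mult_ineq mult_right_mono[OF _ norm_ge_zero]])
    moreover have "norm ((- ?R) ^ n *\<^sub>C y) = R ^ n * norm y"
      using R(1) by (simp add: norm_scaleC norm_power)
    moreover have "emb ((T ^^ n) y) = emb (aev ?p x * y + (- ?R) ^ n *\<^sub>C y)"
      unfolding emb_Tn emb_simps emb_aev[OF p0] upoly_diff by (simp add: algebra_simps)
    then have Tn: "(T ^^ n) y = aev ?p x * y + (- ?R) ^ n *\<^sub>C y"
      by (simp only: emb_inject)
    moreover have "3 * norm y * R ^ n = 2 * R ^ n * norm y + R ^ n * norm y" by simp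
    ultimately show ?thesis
      unfolding a_def Tn using norm_triangle_ineq[of "aev ?p x * y" "(- ?R) ^ n *\<^sub>C y"]
      by linarith
  qed
  have "(norm (T u))\<^sup>2 \<le> norm u * norm (T (T u))" for u
  proof -
    have "star (T u) * T u = star u * T (T u)"
      by (simp add: T_def star_diff star_mult star_scaleC x algebra_simps scaleC_mult_left
          scaleC_mult_right)
    then have "(norm (T u))\<^sup>2 = norm (star u * T (T u))"
      by (simp only: cstar_identity[symmetric])
    then show ?thesis
      using norm_mult_ineq[of "star u" "T (T u)"] by simp
  qed
  then have convex: "(a (Suc n))\<^sup>2 \<le> a n * a (Suc (Suc n))" for n
    by (simp add: a_def)
  have "a 1 \<le> R * a 0"
  proof (cases "a 0 = 0 \<or> a 1 = 0")
    case True
    then show ?thesis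
      using R(1) upper[of 1] by (auto simp: a_def mult_nonneg_nonneg)
  next
    case False
    then have pos: "0 < a 0" "0 < a 1" by (auto simp: a_def)
    define q where "q = a 1 / a 0"
    have q: "0 < q" using pos by (simp add: q_def)
    have growth: "0 < a n \<and> q * a n \<le> a (Suc n)" for n
    proof (induction n)
      case 0
      show ?case using pos by (simp add: q_def)
    next
      case (Suc n)
      then have "0 < q * a n" using q by simp
      with Suc have pos: "0 < a (Suc n)" by linarith
      have "a n * (q * a (Suc n)) \<le> (a (Suc n))\<^sup>2"
        using mult_right_mono[of "q * a n" "a (Suc n)" "a (Suc n)"] Suc pos
        by (simp add: power2_eq_square ac_simps)
      with convex[of n] have "a n * (q * a (Suc n)) \<le> a n * a (Suc (Suc n))" by linarith
      with Suc pos show ?case by simp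
    qed
    have "a 0 * q ^ n \<le> a n" for n
    proof (induction n)
      case (Suc n)
      have "a 0 * q ^ Suc n \<le> q * a n"
        using mult_left_mono[OF Suc, of q] q by (simp add: ac_simps)
      with growth[of n] show ?case by linarith
    qed simp
    then have "q \<le> R"
      using upper pos R(1) by (intro le_if_power_le[of "a 0" R q "3 * norm y"]) (auto intro: order_trans)
    then show ?thesis using pos by (simp add: q_def pos_divide_le_eq)
  qed
  then show ?thesis by (simp add: a_def T_def)
qed

lemma positive_shift_norm:
  fixes x :: "'a::cstar_algebra"
  assumes "positive x"
  shows "norm (x * y - complex_of_real (norm x) *\<^sub>C y) \<le> norm x * norm y"
proof (rule positive_shift_bound)
  show x: "star x = x" using assms by (simp add: positive_iff_uspec)
  fix z assume z: "z \<in> uspec x"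
  have zr: "z = complex_of_real (Re z)"
    using uspec_selfadjoint_real[OF x z] by (simp add: complex_eq_iff)
  have "0 \<le> Re z" "Re z \<le> norm x"
    using assms z abs_Re_le_cmod[of z] norm_uspec_le[OF z] by (auto simp: positive_iff_uspec)
  then have "\<bar>Re z - norm x\<bar> \<le> norm x" by linarith
  moreover have "z - complex_of_real (norm x) = complex_of_real (Re z - norm x)"
    using zr by simp
  ultimately show "cmod (z - complex_of_real (norm x)) \<le> norm x"
    by (simp only: norm_of_real)
qed simp

text \<open>In terms of multiplication operators positivity amounts to \<open>\<parallel>x - R\<parallel> \<le> R\<close> for some
  \<open>R \<ge> 0\<close>, and such bounds can be added.\<close>

lemma positive_add:
  fixes x y :: "'a::cstar_algebra"
  assumes x: "positive x" and y: "positive y"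
  shows "positive (x + y)"
  unfolding positive_iff_uspec
proof (intro conjI ballI)
  have sa: "star x = x" "star y = y" using x y by (auto simp: positive_iff_uspec)
  then show "star (x + y) = x + y" by (simp add: star_add)
  fix z assume z: "z \<in> uspec (x + y)"
  let ?R = "norm x + norm y"
  show "0 \<le> Re z"
  proof (cases "z = 0")
    case False
    have "cmod (z + (- complex_of_real ?R)) \<le> ?R"
    proof (rule uspec_shift_bound[OF _ _ z False])
      fix w
      have eq: "(x + y) * w + (- complex_of_real ?R) *\<^sub>C w =
          (x * w - complex_of_real (norm x) *\<^sub>C w) + (y * w - complex_of_real (norm y) *\<^sub>C w)"
        by (simp add: distrib_right scaleC_add_left algebra_simps)
      show "norm ((x + y) * w + (- complex_of_real ?R) *\<^sub>C w) \<le> ?R * norm w"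
        unfolding eq distrib_right[of "norm x"] using positive_shift_norm[OF x, of w] positive_shift_norm[OF y, of w]
          norm_triangle_ineq[of "x * w - complex_of_real (norm x) *\<^sub>C w"
            "y * w - complex_of_real (norm y) *\<^sub>C w"]
        by linarith
    qed simp
    then have "\<bar>Re z - ?R\<bar> \<le> ?R"
      using abs_Re_le_cmod[of "z + (- complex_of_real ?R)"] by simp
    then show ?thesis by linarith
  qed simp
qed

text \<open>Let \<open>n\<close> be the negative part of \<open>f\<^sup>* f\<close> and \<open>v = f n\<close>.  Then \<open>v\<^sup>* v = n f\<^sup>* f n\<close> is \<open>- w\<^sup>2\<close>
  for a self-adjoint \<open>w\<close>, so that the spectrum of \<open>v\<^sup>* v\<close>, and with it that of \<open>v v\<^sup>*\<close>, has no
  positive points.  On the other hand \<open>2 (v v\<^sup>* + v\<^sup>* v)\<close> is the sum of the squares of the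
  self-adjoint elements \<open>v + v\<^sup>*\<close> and \<open>i (v - v\<^sup>*)\<close>, so that \<open>2 v v\<^sup>*\<close> is a sum of squares and
  therefore positive.  Thus \<open>v = 0\<close>, and the negative part vanishes.\<close>

lemma positive_star_mult_self:
  fixes f :: "'a::cstar_algebra"
  shows "positive (star f * f)"
proof -
  define h where "h = star f * f"
  have h: "star h = h" by (simp add: h_def star_mult star_star)
  define g where "g t = max 0 (- t)" for t :: real
  have "continuous_on UNIV g" "continuous_on UNIV (\<lambda>t. sqrt (g t))"
    unfolding g_def by (intro continuous_intros)+
  then obtain n m where n: "is_cfc h g n" and m: "is_cfc h (\<lambda>t. sqrt (g t)) m"
    using ex_is_cfc[OF h, of g] ex_is_cfc[OF h, of "\<lambda>t. sqrt (g t)"] by (auto simp: g_def)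
  define w where "w = n * m"
  define v where "v = f * n"
  have w: "is_cfc h (\<lambda>t. g t * sqrt (g t)) w"
    unfolding w_def by (rule is_cfc_mult[OF n m])
  have sa: "star n = n" "star w = w"
    by (rule is_cfc_selfadjoint[OF h n] is_cfc_selfadjoint[OF h w])+
  have ww: "is_cfc h (\<lambda>t. (g t * sqrt (g t)) * (g t * sqrt (g t))) (w * w)"
    by (rule is_cfc_mult[OF w w])
  have "star v * v = n * h * n"
    by (simp add: v_def h_def star_mult sa mult.assoc)
  then have vv: "is_cfc h (\<lambda>t. g t * t * g t) (star v * v)"
    using is_cfc_mult[OF is_cfc_mult[OF n is_cfc_self[OF h]] n] by simp
  have "is_cfc h (\<lambda>t. 0) 0"
    using is_cfc_poly[of 0 h "\<lambda>t. 0"] by (simp add: aev_def)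
  from is_cfc_diff[OF this vv] have "0 - star v * v = w * w"
  proof (rule is_cfc_unique[OF h _ ww])
    fix z
    have "0 \<le> g t" "t * g t = - (g t * g t)" for t by (simp_all add: g_def max_def)
    then show "0 - g (Re z) * Re z * g (Re z) =
        (g (Re z) * sqrt (g (Re z))) * (g (Re z) * sqrt (g (Re z)))"
      by (simp add: mult.assoc)
  qed
  then have vw: "star v * v = - (w * w)" by (simp add: minus_equation_iff)
  define x where "x = v * star v"
  have x: "star x = x" by (simp add: x_def star_mult star_star)
  let ?a = "v + star v" and ?b = "\<i> *\<^sub>C (v - star v)"
  have "star ?a = ?a" "star ?b = ?b"
    by (simp_all add: star_add star_diff star_scaleC star_star algebra_simps)
  then have pos: "positive (?a * ?a + ?b * ?b + (w * w + w * w))"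
    by (intro positive_add positive_square sa)
  have "?a * ?a + ?b * ?b = (x + x) + (star v * v + star v * v)"
    by (simp add: x_def algebra_simps scaleC_mult_left scaleC_mult_right scaleC_scaleC scaleC_one)
  with pos have xx: "positive (x + x)" by (simp add: vw)
  have "z = 0" if z: "z \<in> uspec x" for z
  proof -
    have "z \<in> uspec (star v * v)"
      using z uspec_mult_commute[of v "star v"] by (simp add: x_def)
    moreover have "aev [:0, 0, - 1:] w = - (w * w)"
      by (simp add: aev_def usc_simps scaleC_one)
    ultimately have "z \<in> uspec (aev [:0, 0, - 1:] w)" by (simp add: vw)
    then obtain l where l: "l \<in> uspec w" "z = poly [:0, 0, - 1:] l"
      by (rule uspec_aevE) simp
    then have "Re z \<le> 0"
      using uspec_selfadjoint_real[OF sa(2) l(1)] by simp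
    moreover have "aev ([:0, 1:] + [:0, 1:]) x = x + x"
      by (simp only: aev_add aev_X)
    then have "poly ([:0, 1:] + [:0, 1:]) z \<in> uspec (x + x)"
      using poly_in_uspec_aev[of "[:0, 1:] + [:0, 1:]" z x] z by simp
    then have "0 \<le> Re (poly ([:0, 1:] + [:0, 1:]) z)"
      using xx unfolding positive_iff_uspec by blast
    then have "0 \<le> Re z" by simp
    ultimately show "z = 0"
      using uspec_selfadjoint_real[OF x z] by (simp add: complex_eq_iff)
  qed
  moreover obtain z where "z \<in> uspec x" "cmod z = norm x"
    using uspec_selfadjoint_attains_norm[OF x] by blast
  ultimately have "x = 0" by fastforce
  then have "star v = 0"
    using star_mult_self_eq_zero_iff[of "star v"] by (simp add: x_def star_star)
  then have "w * w = 0"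
    using vw by simp
  have "g (Re z) = 0" if "z \<in> uspec h" for z
  proof -
    have "\<not> 0 < (g (Re z) * sqrt (g (Re z))) * (g (Re z) * sqrt (g (Re z)))"
      using abs_cfc_function_le_norm[OF ww that] \<open>w * w = 0\<close> by simp
    then have "g (Re z) * sqrt (g (Re z)) = 0"
      by (simp only: not_real_square_gt_zero)
    then show ?thesis by simp
  qed
  then have "0 \<le> Re z" if "z \<in> uspec h" for z
    using that by (force simp: g_def max_def split: if_splits)
  with h show ?thesis
    by (simp add: positive_iff_uspec flip: h_def)
qed

text \<open>Every positive root of \<open>h\<close> is obtained from \<open>h\<close> by the square root function, since
  \<open>sqrt (t\<^sup>2) = t\<close> on the spectrum of the root.\<close>

lemma ex1_positive_root:
  fixes h :: "'a::cstar_algebra"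
  assumes "positive h"
  shows "\<exists>!y. positive y \<and> y * y = h"
proof -
  have h: "star h = h" and nonneg: "\<And>z. z \<in> uspec h \<Longrightarrow> 0 \<le> Re z"
    using assms by (auto simp: positive_iff_uspec)
  have "continuous_on UNIV sqrt" "continuous_on UNIV (\<lambda>t. sqrt (sqrt t))"
    by (intro continuous_intros)+
  then obtain r q where r: "is_cfc h sqrt r" and q: "is_cfc h (\<lambda>t. sqrt (sqrt t)) q"
    using ex_is_cfc[OF h, of sqrt] ex_is_cfc[OF h, of "\<lambda>t. sqrt (sqrt t)"] by auto
  have "q * q = r"
    by (rule is_cfc_unique[OF h is_cfc_mult[OF q q] r]) (simp add: nonneg)
  moreover have "star q = q" by (rule is_cfc_selfadjoint[OF h q])
  ultimately have "positive r" using positive_square[of q] by simp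
  moreover have "r * r = h"
    by (rule is_cfc_unique[OF h is_cfc_mult[OF r r] is_cfc_self[OF h]]) (simp add: nonneg)
  moreover have "y = r" if y: "positive y" "y * y = h" for y
  proof -
    have sa: "star y = y" using y by (simp add: positive_iff_uspec)
    have "is_cfc (y * y) sqrt r" using r y(2) by simp
    from is_cfc_unique[OF sa is_cfc_self[OF sa] is_cfc_square[OF sa this]] show ?thesis
      using y(1) by (simp add: positive_iff_uspec)
  qed
  ultimately show ?thesis by blast
qed

lemma cstar_abs: "positive (cstar_abs f)" "cstar_abs f * cstar_abs f = star f * f"
  using theI'[OF ex1_positive_root[OF positive_star_mult_self[of f]]]
  by (simp_all add: cstar_abs_def pos_sqrt_def)

section \<open>Units for an element\<close>

text \<open>As \<open>0\<close> is isolated in the spectrum of \<open>s = \<bar>f\<bar>\<close>, the continuous function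
  \<open>\<kappa>(t) = t / max(t\<^sup>2, d\<^sup>2)\<close>, which vanishes at \<open>0\<close>, satisfies \<open>t\<^sup>2 \<kappa>(t) = t\<close> on the spectrum for
  small \<open>d\<close>.  Then \<open>e = s k\<close> with \<open>k = \<kappa>(s)\<close> is the range projection of \<open>s\<close>.  It is a right unit for
  \<open>f\<close>, and \<open>f k k f\<^sup>*\<close> is a left unit.\<close>

lemma isolated_zero_imp_units:
  fixes f :: "'a::cstar_algebra"
  assumes "0 isolated_in spectrum (cstar_abs f)"
  shows "\<exists>e e'. f * e = f \<and> e' * f = f"
proof -
  define s where "s = cstar_abs f"
  have s: "star s = s" "s * s = star f * f"
    using cstar_abs[of f] by (simp_all add: s_def positive_iff_uspec)
  obtain d where d: "0 < d" "\<And>z. z \<in> spectrum s \<Longrightarrow> cmod z < d \<Longrightarrow> z = 0"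
    using assms unfolding isolated_in_dist_Ex_iff s_def by auto
  define \<kappa> where "\<kappa> t = t / max (t * t) (d * d)" for t :: real
  have dpos: "0 < max (t * t) (d * d)" for t :: real using d(1) by (simp add: less_max_iff_disj)
  have "continuous_on UNIV \<kappa>"
    unfolding \<kappa>_def using dpos by (intro continuous_intros) (auto simp: less_imp_neq[symmetric])
  then obtain k where k: "is_cfc s \<kappa> k"
    using ex_is_cfc[OF s(1), of \<kappa>] by (auto simp: \<kappa>_def)
  have id: "is_cfc s (\<lambda>t. t) s" by (rule is_cfc_self[OF s(1)])
  have comm: "k * s = s * k"
    by (rule is_cfc_unique[OF s(1) is_cfc_mult[OF k id] is_cfc_mult[OF id k]]) simp
  have ssk: "s * s * k = s"
  proof (rule is_cfc_unique[OF s(1) is_cfc_mult[OF is_cfc_mult[OF id id] k] id])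
    fix z assume z: "z \<in> uspec s"
    have zr: "cmod z = \<bar>Re z\<bar>"
      using uspec_selfadjoint_real[OF s(1) z] by (simp add: cmod_eq_Re)
    show "Re z * Re z * \<kappa> (Re z) = Re z"
    proof (cases "z = 0")
      case False
      then have "d \<le> \<bar>Re z\<bar>" using d(2)[of z] z zr by (force simp: uspec_eq not_less[symmetric])
      then have "d * d \<le> Re z * Re z"
        using d(1) mult_mono[of d "\<bar>Re z\<bar>" d "\<bar>Re z\<bar>"] by (simp flip: abs_mult)
      moreover have "Re z \<noteq> 0" using False zr by auto
      ultimately show ?thesis by (simp add: \<kappa>_def max_def)
    qed simp
  qed
  define e where "e = s * k"
  have e: "star e = e" "s * e = s"
    using s(1) is_cfc_selfadjoint[OF s(1) k] comm ssk by (simp_all add: e_def star_mult mult.assoc)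
  have "e * s = star (s * e)"
    by (simp add: star_mult e(1) s(1))
  then have es: "e * s = s"
    by (simp only: e(2) s(1))
  have "star (f - f * e) * (f - f * e) = s * s - s * (s * e) - (e * s) * s + (e * s) * (s * e)"
    by (simp add: star_diff star_mult e(1) algebra_simps) (simp add: s(2) flip: mult.assoc)
  also have "\<dots> = 0" by (simp add: e(2) es)
  finally have fe: "f * e = f" by simp
  \<comment> \<open>The left unit is the range projection of \<open>\<bar>f\<^sup>*\<bar>\<close>.\<close>
  have "(f * (k * k) * star f) * f = f * (k * k * (s * s))"
    by (simp only: s(2) mult.assoc)
  also have "k * k * (s * s) = (s * s * k) * k"
    by (metis comm mult.assoc)
  also have "\<dots> = e" by (simp add: ssk e_def)
  finally show ?thesis using fe by metis
qed

lemma compact_element_imp_units: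
  assumes "compact_element f"
  shows "\<exists>e e'. f * e = f \<and> e' * f = f"
proof -
  obtain e where e: "star f = f" "star e = e" "f * e = f"
    using assms unfolding compact_element_def compact_wrt_def positive_def by blast
  then have "e * f = f" using star_mult[of f e] by simp
  with e show ?thesis by blast
qed

section \<open>The Pedersen ideal\<close>

text \<open>If \<open>x\<close> in the ideal satisfies \<open>\<parallel>e - x\<parallel> < 1\<close>, then \<open>a (1 - (e - x)) = a x\<close> where
  \<open>1 - (e - x)\<close> is invertible in the unitization and \<open>a x\<close> lies in the ideal.\<close>

lemma dense_ideal_contains:
  fixes a :: "'a::cstar_algebra"
  assumes I: "two_sided_ideal I" "closure I = UNIV" and ae: "a * e = a"
  shows "a \<in> I"
proof -
  have mult: "u * v \<in> I" "v * u \<in> I" if "u \<in> I" for u v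
    using I(1) that by (auto simp: two_sided_ideal_def)
  have sub: "complex_vector.subspace I" using I(1) by (simp add: two_sided_ideal_def)
  obtain x where x: "x \<in> I" "dist x e < 1"
    using I(2) closure_approachable[of e I] by (auto intro: zero_less_one)
  then have "norm (emb (e - x)) < 1" by (simp add: dist_norm norm_minus_commute)
  then obtain v where v: "(1 - emb (e - x)) * v = 1"
    using invertible_elt_one_minus unfolding invertible_elt_def by blast
  have "emb a * (1 - emb (e - x)) = emb (a * x)"
    using ae by (simp add: algebra_simps flip: emb_simps)
  then have "emb a = emb (a * x) * v"
    using v by (metis mult.assoc mult.right_neutral)
  then have "vec (emb a) = vec (emb (a * x) * v)"
    by (rule arg_cong)
  then have "a = a * x * vec v + sca v *\<^sub>C (a * x)" by simp
  moreover have "a * x * vec v + sca v *\<^sub>C (a * x) \<in> I"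
    by (intro complex_vector.subspace_add complex_vector.subspace_scale sub mult x(1))
  ultimately show ?thesis by simp
qed

text \<open>A self-adjoint \<open>x\<close> is within \<open>d\<close> of its soft threshold \<open>a\<close>, obtained by the function that
  vanishes on \<open>[-d, d]\<close>; the function \<open>min 1 (\<bar>t\<bar> / d)\<close> equals \<open>1\<close> outside this interval and so
  provides a unit for \<open>a\<close>.\<close>

lemma selfadjoint_approx:
  fixes x :: "'a::cstar_algebra"
  assumes x: "star x = x" and d: "0 < d"
  shows "\<exists>a e. a * e = a \<and> norm (x - a) \<le> d"
proof -
  define g where "g t = t - max (- d) (min d t)" for t
  define h where "h t = min 1 (\<bar>t\<bar> / d)" for t
  have "continuous_on UNIV g" "continuous_on UNIV h"
    unfolding g_def h_def using d by (intro continuous_intros; simp)+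
  then obtain a e where a: "is_cfc x g a" and e: "is_cfc x h e"
    using ex_is_cfc[OF x, of g] ex_is_cfc[OF x, of h] d by (auto simp: g_def h_def)
  have "a * e = a"
  proof (rule is_cfc_unique[OF x is_cfc_mult[OF a e] a])
    fix z
    have "g t * h t = g t" for t
    proof (cases "d \<le> \<bar>t\<bar>")
      case True
      then have "h t = 1" using d by (simp add: h_def)
      then show ?thesis by simp
    next
      case False
      then have "g t = 0" using d by (auto simp: g_def max_def min_def)
      then show ?thesis by simp
    qed
    then show "g (Re z) * h (Re z) = g (Re z)" .
  qed
  moreover have "norm (x - a) \<le> d"
    by (rule norm_is_cfc_le[OF x is_cfc_diff[OF is_cfc_self[OF x] a]])
      (use d in \<open>auto simp: g_def max_def min_def\<close>)
  ultimately show ?thesis by blast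
qed

lemma ideal_dense:
  fixes I :: "'a::cstar_algebra set"
  assumes I: "two_sided_ideal I" and K: "\<And>a e. a * e = a \<Longrightarrow> a \<in> I"
  shows "closure I = UNIV"
proof -
  have sub: "complex_vector.subspace I" using I by (simp add: two_sided_ideal_def)
  have "\<exists>y\<in>I. dist y x < d" if d: "0 < d" for x :: 'a and d :: real
  proof -
    let ?p = "x + star x" and ?q = "\<i> *\<^sub>C (x - star x)"
    have "star ?p = ?p" "star ?q = ?q"
      by (simp_all add: star_add star_diff star_scaleC star_star algebra_simps)
    then obtain a b where ab: "a \<in> I" "b \<in> I" "norm (?p - a) \<le> d / 2" "norm (?q - b) \<le> d / 2"
      using selfadjoint_approx[of ?p "d / 2"] selfadjoint_approx[of ?q "d / 2"] K d by fastforce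
    let ?y = "(1/2) *\<^sub>C a - (\<i>/2) *\<^sub>C b"
    have "(1/2) *\<^sub>C ?p - (\<i>/2) *\<^sub>C ?q = (1/2) *\<^sub>C x + (1/2) *\<^sub>C x"
      by (simp add: algebra_simps scaleC_add_right scaleC_scaleC)
    also have "\<dots> = x"
      by (simp add: scaleC_one flip: scaleC_add_left)
    finally have "x - ?y = (1/2) *\<^sub>C (?p - a) - (\<i>/2) *\<^sub>C (?q - b)"
      by (simp add: algebra_simps)
    then have "norm (x - ?y) \<le> norm ((1/2) *\<^sub>C (?p - a)) + norm ((\<i>/2) *\<^sub>C (?q - b))"
      by (metis norm_triangle_ineq4)
    also have "\<dots> < d"
      using ab d by (simp add: norm_scaleC norm_divide)
    finally have "dist ?y x < d" by (simp add: dist_norm norm_minus_commute)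
    moreover have "?y \<in> I"
      using ab sub by (intro complex_vector.subspace_diff complex_vector.subspace_scale)
    ultimately show ?thesis by blast
  qed
  then show ?thesis
    by (auto simp: closure_approachable)
qed

text \<open>The intersection is itself an ideal containing all such \<open>a\<close>, hence dense, and every dense
  ideal occurs in it.\<close>

theorem pedersen_ideal_eq:
  "pedersen_ideal = \<Inter>{I :: 'a::cstar_algebra set. two_sided_ideal I \<and> (\<forall>a e. a * e = a \<longrightarrow> a \<in> I)}"
  (is "_ = \<Inter>?\<I>")
proof -
  have ideal: "two_sided_ideal (\<Inter>?\<I>)"
    unfolding two_sided_ideal_def complex_vector.subspace_def by blast
  show ?thesis
    unfolding pedersen_ideal_def
  proof (rule Least_equality)
    show "two_sided_ideal (\<Inter>?\<I>) \<and> closure (\<Inter>?\<I>) = UNIV"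
      using ideal ideal_dense[OF ideal] by blast
    fix J :: "'a set" assume "two_sided_ideal J \<and> closure J = UNIV"
    then show "\<Inter>?\<I> \<le> J" using dense_ideal_contains[of J] by blast
  qed
qed

lemma pedersen_ideal_subset:
  "two_sided_ideal I \<Longrightarrow> (\<And>a e. a * e = a \<Longrightarrow> a \<in> I) \<Longrightarrow> pedersen_ideal \<subseteq> I"
  unfolding pedersen_ideal_eq by blast

lemma two_sided_ideal_pedersen: "two_sided_ideal pedersen_ideal"
  unfolding pedersen_ideal_eq two_sided_ideal_def complex_vector.subspace_def by blast

lemma mem_pedersen_ideal: "a * e = a \<Longrightarrow> a \<in> pedersen_ideal"
  unfolding pedersen_ideal_eq by blast

section \<open>Slice maps\<close>

lemma tensor_mult: "(d \<otimes>\<^sub>a a) * (d' \<otimes>\<^sub>a a') = (d * d') \<otimes>\<^sub>a (a * a')"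
  by transfer (simp add: tensor_rel_def free_mult_simps tensor_null_zero)

lemma tensor_add_right: "d \<otimes>\<^sub>a (a + a') = d \<otimes>\<^sub>a a + d \<otimes>\<^sub>a a'"
  by transfer (use tensor_relationsI(2) in \<open>simp add: tensor_rel_def diff_diff_eq\<close>)

lemma tensor_scaleC_right: "d \<otimes>\<^sub>a (c *\<^sub>C a) = c *\<^sub>C (d \<otimes>\<^sub>a a)"
  by transfer (simp add: tensor_rel_def tensor_relationsI)

lemma star_homD:
  assumes "star_hom h"
  shows "h (x + y) = h x + h y" "h (c *\<^sub>C x) = c *\<^sub>C h x" "h (x * y) = h x * h y"
proof -
  interpret Vector_Spaces.linear "(*\<^sub>C)" "(*\<^sub>C)" h
    using assms by (simp add: star_hom_def)
  show "h (x + y) = h x + h y" "h (c *\<^sub>C x) = c *\<^sub>C h x" by (rule add scale)+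
  show "h (x * y) = h x * h y" using assms by (simp add: star_hom_def)
qed

text \<open>The elements \<open>a\<close> with \<open>\<pi>(f \<otimes> a)\<close> in the Pedersen ideal form a two-sided ideal, because
  \<open>f \<otimes> x a = (e' \<otimes> x) (f \<otimes> a)\<close> and \<open>f \<otimes> a x = (f \<otimes> a) (e \<otimes> x)\<close>.  It contains every \<open>a\<close> with
  \<open>a u = a\<close> for some \<open>u\<close>, because then \<open>(f \<otimes> a) (e \<otimes> u) = f \<otimes> a\<close>.\<close>

lemma slice_maps_pedersen_ideal:
  fixes \<pi> :: "('d::cstar_algebra, 'a::cstar_algebra) atensor \<Rightarrow> 'b::cstar_algebra"
  assumes add: "\<And>x y. \<pi> (x + y) = \<pi> x + \<pi> y" and scale: "\<And>c x. \<pi> (c *\<^sub>C x) = c *\<^sub>C \<pi> x"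
    and mult: "\<And>x y. \<pi> (x * y) = \<pi> x * \<pi> y"
    and e: "f * e = f" and e': "e' * f = f" and a: "a \<in> pedersen_ideal"
  shows "\<pi> (f \<otimes>\<^sub>a a) \<in> pedersen_ideal"
proof -
  let ?J = "{a. \<pi> (f \<otimes>\<^sub>a a) \<in> pedersen_ideal}"
  have P: "complex_vector.subspace (pedersen_ideal :: 'b set)"
    "\<And>x y :: 'b. x \<in> pedersen_ideal \<Longrightarrow> x * y \<in> pedersen_ideal \<and> y * x \<in> pedersen_ideal"
    using two_sided_ideal_pedersen by (auto simp: two_sided_ideal_def)
  have right: "\<pi> (f \<otimes>\<^sub>a (a * x)) = \<pi> (f \<otimes>\<^sub>a a) * \<pi> (e \<otimes>\<^sub>a x)" for a x
    by (simp add: e tensor_mult flip: mult)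
  have left: "\<pi> (f \<otimes>\<^sub>a (x * a)) = \<pi> (e' \<otimes>\<^sub>a x) * \<pi> (f \<otimes>\<^sub>a a)" for a x
    by (simp add: e' tensor_mult flip: mult)
  have zero: "\<pi> (f \<otimes>\<^sub>a 0) = 0"
    using tensor_scaleC_right[of f 0 "0 :: 'a"] scale[of 0 "f \<otimes>\<^sub>a 0"] by simp
  have "two_sided_ideal ?J"
    unfolding two_sided_ideal_def
  proof (intro conjI ballI allI)
    show "complex_vector.subspace ?J"
      using complex_vector.subspace_0[OF P(1)]
      by (intro complex_vector.subspaceI)
        (auto simp: zero tensor_add_right tensor_scaleC_right add scale
          intro: complex_vector.subspace_add[OF P(1)] complex_vector.subspace_scale[OF P(1)])
  next
    fix b x assume b: "b \<in> ?J"
    then show "b * x \<in> ?J" using P(2) by (simp add: right)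
    show "x * b \<in> ?J" using P(2) b by (simp add: left)
  qed
  moreover have "b \<in> ?J" if "b * u = b" for b u
  proof -
    have "\<pi> (f \<otimes>\<^sub>a b) * \<pi> (e \<otimes>\<^sub>a u) = \<pi> (f \<otimes>\<^sub>a b)"
      using right[of b u] that by simp
    then show ?thesis using mem_pedersen_ideal by blast
  qed
  ultimately have "pedersen_ideal \<subseteq> ?J" by (rule pedersen_ideal_subset)
  with a show ?thesis by blast
qed

theorem corollary4p7:
  fixes \<beta> :: "('d::cstar_algebra, 'a::cstar_algebra) atensor \<Rightarrow> real"
    and \<iota> :: "('d, 'a) atensor \<Rightarrow> 'e::cstar_algebra"
    and \<rho> :: "'e \<Rightarrow> 'b::cstar_algebra"
    and f :: 'd
  assumes "cstar_norm \<beta>"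
    and "cstar_completion \<beta> \<iota>"
    and "star_hom \<rho>"
    and "compact_element f \<or> 0 isolated_in spectrum (cstar_abs f)"
  shows "(\<lambda>a. \<rho> (\<iota> (f \<otimes>\<^sub>a a))) ` (pedersen_ideal :: 'a set) \<subseteq> (pedersen_ideal :: 'b set)"
proof (rule image_subsetI)
  fix a :: 'a assume a: "a \<in> pedersen_ideal"
  have "star_hom \<iota>" using assms(2) by (simp add: cstar_completion_def)
  note hom = star_homD[OF this] star_homD[OF assms(3)]
  obtain e e' where "f * e = f" "e' * f = f"
    using assms(4) compact_element_imp_units isolated_zero_imp_units by blast
  then show "\<rho> (\<iota> (f \<otimes>\<^sub>a a)) \<in> pedersen_ideal"
    using a by (intro slice_maps_pedersen_ideal[where \<pi> = "\<lambda>x. \<rho> (\<iota> x)"]) (simp_all add: hom)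
qed

end
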